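(* Let $X$ be a locally compact Hausdorff space, let $\phi:X\to X$ be a continuous proper surjection, and let $\{X_n\}_{n=0}^\infty$ be a sequence of closed subsets of $X$ such that $X_{n+1}\cup\phi(X_{n+1})\subseteq X_n$ for all $n\in\mathbb Z_+$. Let $\mathcal I\sim\{X_n\}_{n=0}^\infty$ be the associated ideal of the semicrossed product $C_0(X)\times_\phi\mathbb Z_+$, that is, $\mathcal I=\{A\in C_0(X)\times_\phi\mathbb Z_+ : E_n(A)(X_n)=\{0\}\text{ for all } n\in\mathbb Z_+\}$, and suppose $\mathcal I$ is non-zero. The following are equivalent: (1) $\mathcal I$ has a right approximate unit. (2) $X_n=X_{n+1}$ for all $n\in\mathbb Z_+$.
   Context: $\mathbb Z_+=\{0,1,2,\dots\}$. A map $\phi:X\to X$ is proper if $\phi^{-1}(K)$ is compact for every compact $K\subseteq X$. For $f\in C_0(X)$ and $n\in\mathbb Z_+$ put $\alpha^n(f)=\alpha_n(f)=f\circ\phi^n$. Semicrossed product: $\ell^1(\mathbb Z_+,C_0(X))$ is the Banach space of formal series $A=\sum_{n\in\mathbb Z_+}U^nf_n$, $f_n\in C_0(X)$, with norm $\|A\|_1=\sum_n\|f_n\|_{C_0(X)}<\infty$; it is a Banach algebra under the multiplication $(U^nf)(U^mg)=U^{n+m}(\alpha^m(f)g)$, extended by linearity and continuity. Let $C_0(X)$ act faithfully on a Hilbert space $\mathcal H_0$. Define a faithful contractive representation $\pi$ of $\ell^1(\mathbb Z_+,C_0(X))$ on $\mathcal H=\mathcal H_0\otimes\ell^2(\mathbb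 Z_+)$ by $\pi(U^nf)(\xi\otimes e_k)=\alpha^k(f)\xi\otimes e_{k+n}$. The semicrossed product $C_0(X)\times_\phi\mathbb Z_+$ is the norm closure of the image of $\pi$ in $\mathcal B(\mathcal H)$; $\pi(U^nf)$ is written $U^nf$. Fourier coefficients: the maps $E_n:\ell^1(\mathbb Z_+,C_0(X))\to C_0(X)$, $E_n(\sum_m U^mf_m)=f_n$, are contractive for the operator norm and hence extend to contractions $E_n:C_0(X)\times_\phi\mathbb Z_+\to C_0(X)$. Approximate units: a left (resp. right) approximate unit of a Banach algebra $\mathcal A$ is a net $\{u_\lambda\}_{\lambda\in\Lambda}$ in $\mathcal A$ such that, for some $r>0$, $\|u_\lambda\|\le r$ for all $\lambda\in\Lambda$, and $\lim_\lambda u_\lambda a=a$ (resp. $\lim_\lambda au_\lambda=a$) in norm for all $a\in\mathcal A$. An ideal $\mathcal I$ of a Banach algebra has a left (resp. right) approximate unit if it has one as an algebra (in particular the net lies in $\mathcal I$). *)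

theory Defs
  imports "HOL-Analysis.Analysis"
begin

section \<open>Complex Hilbert spaces\<close>

text \<open>The inner product is linear in its first argument.\<close>

class complex_hilbert = banach +
  fixes scaleC :: "complex \<Rightarrow> 'a \<Rightarrow> 'a" (infixr \<open>*\<^sub>C\<close> 75)
    and cinner :: "'a \<Rightarrow> 'a \<Rightarrow> complex"
  assumes scaleC_add_right: "c *\<^sub>C (x + y) = c *\<^sub>C x + c *\<^sub>C y"
    and scaleC_add_left: "(c + d) *\<^sub>C x = c *\<^sub>C x + d *\<^sub>C x"
    and scaleC_scaleC: "c *\<^sub>C d *\<^sub>C x = (c * d) *\<^sub>C x"
    and scaleR_eq_scaleC: "r *\<^sub>R x = complex_of_real r *\<^sub>C x"
    and cinner_commute: "cinner x y = cnj (cinner y x)"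
    and cinner_add_left: "cinner (x + y) z = cinner x z + cinner y z"
    and cinner_scaleC_left: "cinner (c *\<^sub>C x) y = c * cinner x y"
    and cinner_self: "cinner x x = complex_of_real ((norm x)\<^sup>2)"
begin

lemma cinner_add_right: "cinner x (y + z) = cinner x y + cinner x z"
  by (metis cinner_commute cinner_add_left complex_cnj_add)

lemma cinner_scaleC_right: "cinner x (c *\<^sub>C y) = cnj c * cinner x y"
  by (metis cinner_commute cinner_scaleC_left complex_cnj_mult)

lemma norm_add_sq: "(norm (x + y))\<^sup>2 = (norm x)\<^sup>2 + 2 * Re (cinner x y) + (norm y)\<^sup>2"
proof -
  have "complex_of_real ((norm (x + y))\<^sup>2) = cinner (x + y) (x + y)"
    by (simp only: cinner_self)
  also have "\<dots> = cinner x x + (cinner x y + cnj (cinner x y)) + cinner y y"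
    by (simp add: cinner_add_left cinner_add_right cinner_commute[of y x])
  also have "\<dots> = complex_of_real ((norm x)\<^sup>2 + 2 * Re (cinner x y) + (norm y)\<^sup>2)"
    by (simp only: cinner_self complex_add_cnj of_real_add)
  finally show ?thesis
    by (simp only: of_real_eq_iff)
qed

lemma norm_scaleC: "norm (c *\<^sub>C x) = cmod c * norm x"
proof -
  have "complex_of_real ((norm (c *\<^sub>C x))\<^sup>2) = cinner (c *\<^sub>C x) (c *\<^sub>C x)"
    by (simp only: cinner_self)
  also have "\<dots> = (c * cnj c) * cinner x x"
    by (simp add: cinner_scaleC_left cinner_scaleC_right)
  also have "\<dots> = complex_of_real ((cmod c * norm x)\<^sup>2)"
    by (simp add: cinner_self complex_norm_square[symmetric] power_mult_distrib)
  finally have "(norm (c *\<^sub>C x))\<^sup>2 = (cmod c * norm x)\<^sup>2"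
    by (simp only: of_real_eq_iff)
  then show ?thesis
    by (simp add: power2_eq_iff_nonneg)
qed

lemma scaleC_zero_right: "c *\<^sub>C 0 = 0"
  using norm_scaleC[of c 0] by simp

lemma norm_cinner: "cmod (cinner x y) \<le> norm x * norm y"
proof (cases "norm y = 0")
  case True
  then have "y = 0" by simp
  then show ?thesis
    using cinner_scaleC_right[of x 0 0] by (simp add: scaleC_zero_right)
next
  case False
  define c where "c = - (cinner x y / complex_of_real ((norm y)\<^sup>2))"
  have "0 \<le> (norm (x + c *\<^sub>C y))\<^sup>2" by simp
  also have "\<dots> = (norm x)\<^sup>2 + 2 * Re (cnj c * cinner x y) + (cmod c * norm y)\<^sup>2"
    by (simp only: norm_add_sq cinner_scaleC_right norm_scaleC)
  also have "cnj c * cinner x y = complex_of_real (- ((cmod (cinner x y))\<^sup>2 / (norm y)\<^sup>2))"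
    by (simp add: c_def complex_norm_square[symmetric] mult.commute del: of_real_power)
  also have "(cmod c * norm y)\<^sup>2 = (cmod (cinner x y))\<^sup>2 / (norm y)\<^sup>2"
    using False by (simp add: c_def norm_divide norm_mult power2_eq_square divide_simps)
  finally have "(cmod (cinner x y))\<^sup>2 / (norm y)\<^sup>2 \<le> (norm x)\<^sup>2"
    by simp
  then have "(cmod (cinner x y))\<^sup>2 \<le> (norm x * norm y)\<^sup>2"
    using False by (simp add: field_simps power_mult_distrib)
  then show ?thesis
    by (simp add: abs_le_square_iff[symmetric])
qed

end


section \<open>The Hilbert tensor product of a Hilbert space with \<open>\<ell>\<^sup>2(\<int>\<^sub>+)\<close>\<close>

text \<open>\<open>\<H>\<^sub>0 \<otimes> \<ell>\<^sup>2(\<int>\<^sub>+)\<close> is realised as the space of square-summable sequences in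
  \<open>\<H>\<^sub>0\<close>; the elementary tensor \<open>\<xi> \<otimes> e\<^sub>k\<close> is the sequence with \<open>\<xi>\<close> in place \<open>k\<close> and \<open>0\<close>
  elsewhere.\<close>

typedef (overloaded) 'h ell2 = "{x :: nat \<Rightarrow> 'h::real_normed_vector. summable (\<lambda>n. (norm (x n))\<^sup>2)}"
  morphisms ell2_nth Abs_ell2
  by (rule exI[of _ "\<lambda>_. 0"]) simp

setup_lifting type_definition_ell2

lemma ell2_eqI: "(\<And>n. ell2_nth x n = ell2_nth y n) \<Longrightarrow> x = y"
  by transfer auto

lemma summable_ell2: "summable (\<lambda>n. (norm (ell2_nth x n))\<^sup>2)"
  by transfer simp

lemma ell2_add_aux:
  fixes x y :: "nat \<Rightarrow> 'h::real_normed_vector"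
  assumes x: "summable (\<lambda>n. (norm (x n))\<^sup>2)" and y: "summable (\<lambda>n. (norm (y n))\<^sup>2)"
  shows "summable (\<lambda>n. (norm (x n + y n))\<^sup>2)"
    and "sqrt (\<Sum>n. (norm (x n + y n))\<^sup>2) \<le> sqrt (\<Sum>n. (norm (x n))\<^sup>2) + sqrt (\<Sum>n. (norm (y n))\<^sup>2)"
proof -
  show s: "summable (\<lambda>n. (norm (x n + y n))\<^sup>2)"
  proof (rule summable_comparison_test'[where N = 0])
    show "summable (\<lambda>n. 2 * (norm (x n))\<^sup>2 + 2 * (norm (y n))\<^sup>2)"
      using x y by (intro summable_add summable_mult)
    fix n :: nat
    have "(norm (x n + y n))\<^sup>2 \<le> (norm (x n) + norm (y n))\<^sup>2"
      by (intro power_mono norm_triangle_ineq) simp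
    also have "\<dots> \<le> 2 * (norm (x n))\<^sup>2 + 2 * (norm (y n))\<^sup>2"
      using zero_le_power2[of "norm (x n) - norm (y n)"]
      by (simp add: power2_eq_square algebra_simps)
    finally show "norm ((norm (x n + y n))\<^sup>2) \<le> 2 * (norm (x n))\<^sup>2 + 2 * (norm (y n))\<^sup>2"
      by simp
  qed
  show "sqrt (\<Sum>n. (norm (x n + y n))\<^sup>2) \<le> sqrt (\<Sum>n. (norm (x n))\<^sup>2) + sqrt (\<Sum>n. (norm (y n))\<^sup>2)"
  proof (rule LIMSEQ_le)
    show "(\<lambda>N. sqrt (\<Sum>n<N. (norm (x n + y n))\<^sup>2)) \<longlonglongrightarrow> sqrt (\<Sum>n. (norm (x n + y n))\<^sup>2)"
      by (intro tendsto_real_sqrt summable_LIMSEQ s)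
    show "(\<lambda>N. sqrt (\<Sum>n<N. (norm (x n))\<^sup>2) + sqrt (\<Sum>n<N. (norm (y n))\<^sup>2))
        \<longlonglongrightarrow> sqrt (\<Sum>n. (norm (x n))\<^sup>2) + sqrt (\<Sum>n. (norm (y n))\<^sup>2)"
      by (intro tendsto_add tendsto_real_sqrt summable_LIMSEQ x y)
    have "sqrt (\<Sum>n<N. (norm (x n + y n))\<^sup>2)
        \<le> sqrt (\<Sum>n<N. (norm (x n))\<^sup>2) + sqrt (\<Sum>n<N. (norm (y n))\<^sup>2)" for N
    proof -
      have "sqrt (\<Sum>n<N. (norm (x n + y n))\<^sup>2) \<le> sqrt (\<Sum>n<N. (norm (x n) + norm (y n))\<^sup>2)"
        by (intro real_sqrt_le_mono sum_mono power_mono norm_triangle_ineq) simp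
      also have "\<dots> \<le> sqrt (\<Sum>n<N. (norm (x n))\<^sup>2) + sqrt (\<Sum>n<N. (norm (y n))\<^sup>2)"
        using L2_set_triangle_ineq[of "\<lambda>n. norm (x n)" "\<lambda>n. norm (y n)" "{..<N}"]
        by (simp add: L2_set_def)
      finally show ?thesis .
    qed
    then show "\<exists>N. \<forall>n\<ge>N. sqrt (\<Sum>i<n. (norm (x i + y i))\<^sup>2)
        \<le> sqrt (\<Sum>i<n. (norm (x i))\<^sup>2) + sqrt (\<Sum>i<n. (norm (y i))\<^sup>2)"
      by blast
  qed
qed

instantiation ell2 :: (real_normed_vector) real_vector
begin

lift_definition zero_ell2 :: "'a ell2" is "\<lambda>_. 0" by simp
lift_definition plus_ell2 :: "'a ell2 \<Rightarrow> 'a ell2 \<Rightarrow> 'a ell2" is "\<lambda>x y n. x n + y n"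
  by (rule ell2_add_aux(1))
lift_definition uminus_ell2 :: "'a ell2 \<Rightarrow> 'a ell2" is "\<lambda>x n. - x n" by simp
lift_definition minus_ell2 :: "'a ell2 \<Rightarrow> 'a ell2 \<Rightarrow> 'a ell2" is "\<lambda>x y n. x n - y n"
  using ell2_add_aux(1)[where y = "\<lambda>n. - y n" for y] by simp
lift_definition scaleR_ell2 :: "real \<Rightarrow> 'a ell2 \<Rightarrow> 'a ell2" is "\<lambda>r x n. r *\<^sub>R x n"
  by (simp add: power_mult_distrib summable_mult)

instance
proof
  fix x y z :: "'a ell2" and a b :: real
  show "x + y + z = x + (y + z)" by transfer (simp add: add.assoc)
  show "x + y = y + x" by transfer (simp add: add.commute)
  show "0 + x = x" by transfer simp
  show "- x + x = 0" by transfer simp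
  show "x - y = x + - y" by transfer simp
  show "a *\<^sub>R (x + y) = a *\<^sub>R x + a *\<^sub>R y" by transfer (simp add: scaleR_add_right)
  show "(a + b) *\<^sub>R x = a *\<^sub>R x + b *\<^sub>R x" by transfer (simp add: scaleR_add_left)
  show "a *\<^sub>R b *\<^sub>R x = (a * b) *\<^sub>R x" by transfer simp
  show "1 *\<^sub>R x = x" by transfer simp
qed

end

instantiation ell2 :: (real_normed_vector) real_normed_vector
begin

lift_definition norm_ell2 :: "'a ell2 \<Rightarrow> real" is "\<lambda>x. sqrt (\<Sum>n. (norm (x n))\<^sup>2)" .

definition dist_ell2 :: "'a ell2 \<Rightarrow> 'a ell2 \<Rightarrow> real" where "dist_ell2 x y = norm (x - y)"
definition sgn_ell2 :: "'a ell2 \<Rightarrow> 'a ell2" where "sgn_ell2 x = x /\<^sub>R norm x"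
definition uniformity_ell2 :: "('a ell2 \<times> 'a ell2) filter"
  where "uniformity_ell2 = (INF e\<in>{0 <..}. principal {(x, y). dist x y < e})"
definition open_ell2 :: "'a ell2 set \<Rightarrow> bool"
  where "open_ell2 S = (\<forall>x\<in>S. \<forall>\<^sub>F (x', y) in uniformity. x' = x \<longrightarrow> y \<in> S)"

instance
proof
  fix x y :: "'a ell2" and a :: real
  show "dist x y = norm (x - y)" by (rule dist_ell2_def)
  show "sgn x = x /\<^sub>R norm x" by (rule sgn_ell2_def)
  show "norm x = 0 \<longleftrightarrow> x = 0" by transfer (auto simp: suminf_eq_zero_iff)
  show "norm (x + y) \<le> norm x + norm y" by transfer (rule ell2_add_aux(2))
  show "norm (a *\<^sub>R x) = \<bar>a\<bar> * norm x"
    by transfer (simp add: power_mult_distrib suminf_mult real_sqrt_mult)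
qed (rule uniformity_ell2_def open_ell2_def)+

end

lemmas ell2_nth_simps [simp] = zero_ell2.rep_eq plus_ell2.rep_eq uminus_ell2.rep_eq
  minus_ell2.rep_eq scaleR_ell2.rep_eq

lemma norm_ell2_sq: "(norm x)\<^sup>2 = (\<Sum>n. (norm (ell2_nth x n))\<^sup>2)"
  by transfer (simp add: suminf_nonneg)

lemma ell2_partial_le: "(\<Sum>n<N. (norm (ell2_nth x n))\<^sup>2) \<le> (norm x)\<^sup>2"
  unfolding norm_ell2_sq by (intro sum_le_suminf summable_ell2) auto

lemma norm_ell2_nth_le: "norm (ell2_nth x n) \<le> norm x"
proof -
  have "(norm (ell2_nth x n))\<^sup>2 \<le> (\<Sum>i<Suc n. (norm (ell2_nth x i))\<^sup>2)"
    by (simp add: sum_nonneg)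
  also have "\<dots> \<le> (norm x)\<^sup>2" by (rule ell2_partial_le)
  finally show ?thesis by (simp add: abs_le_square_iff[symmetric])
qed

instance ell2 :: (banach) banach
proof
  fix X :: "nat \<Rightarrow> 'a ell2"
  assume C: "Cauchy X"
  have "Cauchy (\<lambda>j. ell2_nth (X j) n)" for n
  proof (rule CauchyI)
    fix e :: real assume "0 < e"
    then obtain M where M: "\<forall>i\<ge>M. \<forall>j\<ge>M. norm (X i - X j) < e"
      using CauchyD[OF C] by blast
    have "norm (ell2_nth (X i) n - ell2_nth (X j) n) < e" if "i \<ge> M" "j \<ge> M" for i j
      using norm_ell2_nth_le[of "X i - X j" n] M that by (auto intro: le_less_trans)
    then show "\<exists>M. \<forall>i\<ge>M. \<forall>j\<ge>M. norm (ell2_nth (X i) n - ell2_nth (X j) n) < e"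
      by blast
  qed
  then have "\<exists>l. (\<lambda>j. ell2_nth (X j) n) \<longlonglongrightarrow> l" for n
    using Cauchy_convergent convergent_def by blast
  then obtain l where l: "\<And>n. (\<lambda>j. ell2_nth (X j) n) \<longlonglongrightarrow> l n"
    by metis
  have key: "(\<Sum>n<N. (norm (ell2_nth (X i) n - l n))\<^sup>2) \<le> e\<^sup>2"
    if M: "\<forall>i\<ge>M. \<forall>j\<ge>M. norm (X i - X j) < e" and i: "i \<ge> M" for M e i N
  proof (rule LIMSEQ_le_const2)
    show "(\<lambda>j. \<Sum>n<N. (norm (ell2_nth (X i) n - ell2_nth (X j) n))\<^sup>2)
        \<longlonglongrightarrow> (\<Sum>n<N. (norm (ell2_nth (X i) n - l n))\<^sup>2)"
      by (intro tendsto_intros l)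
    have "(\<Sum>n<N. (norm (ell2_nth (X i) n - ell2_nth (X j) n))\<^sup>2) \<le> e\<^sup>2" if "j \<ge> M" for j
    proof -
      have "(\<Sum>n<N. (norm (ell2_nth (X i) n - ell2_nth (X j) n))\<^sup>2) \<le> (norm (X i - X j))\<^sup>2"
        using ell2_partial_le[where x = "X i - X j" and N = N] by simp
      also have "\<dots> \<le> e\<^sup>2"
        using M i that by (intro power_mono) (auto intro: less_imp_le)
      finally show ?thesis .
    qed
    then show "\<exists>J. \<forall>j\<ge>J. (\<Sum>n<N. (norm (ell2_nth (X i) n - ell2_nth (X j) n))\<^sup>2) \<le> e\<^sup>2"
      by blast
  qed
  have bound: "summable (\<lambda>n. (norm (ell2_nth (X i) n - l n))\<^sup>2)
      \<and> (\<Sum>n. (norm (ell2_nth (X i) n - l n))\<^sup>2) \<le> e\<^sup>2"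
    if M: "\<forall>i\<ge>M. \<forall>j\<ge>M. norm (X i - X j) < e" and i: "i \<ge> M" for M e i
  proof -
    have s: "summable (\<lambda>n. (norm (ell2_nth (X i) n - l n))\<^sup>2)"
    proof (rule bounded_imp_summable)
      show "(\<Sum>k\<le>n. (norm (ell2_nth (X i) k - l k))\<^sup>2) \<le> e\<^sup>2" for n
        using key[OF M i, of "Suc n"] by (simp add: lessThan_Suc_atMost)
    qed simp
    then show ?thesis
      using suminf_le_const[OF s key[OF M i]] by simp
  qed
  obtain M0 where M0: "\<forall>i\<ge>M0. \<forall>j\<ge>M0. norm (X i - X j) < 1"
    using CauchyD[OF C, of 1] by auto
  have "summable (\<lambda>n. (norm (ell2_nth (X M0) n + - (ell2_nth (X M0) n - l n)))\<^sup>2)"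
    using bound[OF M0 order.refl] summable_ell2[of "X M0"]
    by (intro ell2_add_aux(1)) (auto simp: norm_minus_commute)
  then have "summable (\<lambda>n. (norm (l n))\<^sup>2)" by simp
  then obtain L where L: "ell2_nth L = l"
    by (metis Abs_ell2_inverse mem_Collect_eq)
  have "X \<longlonglongrightarrow> L"
  proof (rule LIMSEQ_I)
    fix r :: real assume r: "0 < r"
    then obtain M where M: "\<forall>i\<ge>M. \<forall>j\<ge>M. norm (X i - X j) < r / 2"
      using CauchyD[OF C, of "r / 2"] by auto
    have "norm (X i - L) < r" if "i \<ge> M" for i
    proof -
      have "(norm (X i - L))\<^sup>2 \<le> (r / 2)\<^sup>2"
        using bound[OF M that] by (simp add: norm_ell2_sq L)
      then have "norm (X i - L) \<le> r / 2"
        using r by (simp add: abs_le_square_iff[symmetric])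
      then show ?thesis using r by simp
    qed
    then show "\<exists>M. \<forall>i\<ge>M. norm (X i - L) < r" by blast
  qed
  then show "convergent X" by (rule convergentI)
qed

lemma summable_cinner_ell2:
  fixes x y :: "'h::complex_hilbert ell2"
  shows "summable (\<lambda>n. cinner (ell2_nth x n) (ell2_nth y n))"
proof (rule summable_comparison_test'[where N = 0])
  show "summable (\<lambda>n. (norm (ell2_nth x n))\<^sup>2 + (norm (ell2_nth y n))\<^sup>2)"
    by (intro summable_add summable_ell2)
  fix n :: nat
  have "norm (cinner (ell2_nth x n) (ell2_nth y n)) \<le> norm (ell2_nth x n) * norm (ell2_nth y n)"
    by (rule norm_cinner)
  also have "\<dots> \<le> (norm (ell2_nth x n))\<^sup>2 + (norm (ell2_nth y n))\<^sup>2"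
    using sum_squares_bound[of "norm (ell2_nth x n)" "norm (ell2_nth y n)"]
      mult_nonneg_nonneg[OF norm_ge_zero[of "ell2_nth x n"] norm_ge_zero[of "ell2_nth y n"]]
    by linarith
  finally show "norm (cinner (ell2_nth x n) (ell2_nth y n))
      \<le> (norm (ell2_nth x n))\<^sup>2 + (norm (ell2_nth y n))\<^sup>2" .
qed

instantiation ell2 :: (complex_hilbert) complex_hilbert
begin

lift_definition scaleC_ell2 :: "complex \<Rightarrow> 'a ell2 \<Rightarrow> 'a ell2" is "\<lambda>c x n. c *\<^sub>C x n"
  by (simp add: norm_scaleC power_mult_distrib summable_mult)
definition cinner_ell2 :: "'a ell2 \<Rightarrow> 'a ell2 \<Rightarrow> complex"
  where "cinner_ell2 x y = (\<Sum>n. cinner (ell2_nth x n) (ell2_nth y n))"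

instance
proof
  fix x y z :: "'a ell2" and c d :: complex and r :: real
  show "c *\<^sub>C (x + y) = c *\<^sub>C x + c *\<^sub>C y" by transfer (simp add: scaleC_add_right)
  show "(c + d) *\<^sub>C x = c *\<^sub>C x + d *\<^sub>C x" by transfer (simp add: scaleC_add_left)
  show "c *\<^sub>C d *\<^sub>C x = (c * d) *\<^sub>C x" by transfer (simp add: scaleC_scaleC)
  show "r *\<^sub>R x = complex_of_real r *\<^sub>C x" by transfer (simp add: scaleR_eq_scaleC)
  show "cinner x y = cnj (cinner y x)"
    unfolding cinner_ell2_def
    using bounded_linear.suminf[OF bounded_linear_cnj summable_cinner_ell2[of y x]]
    by (simp add: cinner_commute[symmetric])
  show "cinner (x + y) z = cinner x z + cinner y z"
    by (simp add: cinner_ell2_def cinner_add_left suminf_add[symmetric] summable_cinner_ell2)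
  show "cinner (c *\<^sub>C x) y = c * cinner x y"
    by (simp add: cinner_ell2_def scaleC_ell2.rep_eq cinner_scaleC_left suminf_mult
        summable_cinner_ell2)
  show "cinner x x = complex_of_real ((norm x)\<^sup>2)"
    by (simp add: cinner_ell2_def cinner_self norm_ell2_sq suminf_of_real[OF summable_ell2]
        del: of_real_power)
qed

end

lift_definition ell2_single :: "'h::real_normed_vector \<Rightarrow> nat \<Rightarrow> 'h ell2"  (infixl \<open>\<otimes>e\<close> 70)
  is "\<lambda>\<xi> k n. if n = k then \<xi> else 0"
proof -
  fix \<xi> :: 'h and k :: nat
  show "summable (\<lambda>n. (norm (if n = k then \<xi> else 0))\<^sup>2)"
    by (rule summable_finite[of "{k}"]) auto
qed


section \<open>The algebra \<open>C\<^sub>0(X)\<close> and its faithful representations\<close>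

text \<open>\<open>C\<^sub>0(X)\<close> is a subset of the bounded continuous functions with their supremum norm.\<close>

definition C0 :: "('a::topological_space \<Rightarrow>\<^sub>C complex) set" where
  "C0 = {f. \<forall>e>0. compact {x. e \<le> cmod (apply_bcontfun f x)}}"

definition scaleC_fun :: "complex \<Rightarrow> ('a::topological_space \<Rightarrow>\<^sub>C complex) \<Rightarrow> ('a \<Rightarrow>\<^sub>C complex)" where
  "scaleC_fun c f = Bcontfun (\<lambda>x. c * apply_bcontfun f x)"

definition times_fun ::
    "('a::topological_space \<Rightarrow>\<^sub>C complex) \<Rightarrow> ('a \<Rightarrow>\<^sub>C complex) \<Rightarrow> ('a \<Rightarrow>\<^sub>C complex)" where
  "times_fun f g = Bcontfun (\<lambda>x. apply_bcontfun f x * apply_bcontfun g x)"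

definition cnj_fun :: "('a::topological_space \<Rightarrow>\<^sub>C complex) \<Rightarrow> ('a \<Rightarrow>\<^sub>C complex)" where
  "cnj_fun f = Bcontfun (\<lambda>x. cnj (apply_bcontfun f x))"

text \<open>Faithful *-representation of \<open>C\<^sub>0(X)\<close> by bounded complex-linear operators.
  Non-degeneracy is not required. The values of \<open>\<rho>\<close> outside \<open>C\<^sub>0(X)\<close> are irrelevant.\<close>

definition faithful_representation ::
    "(('a::topological_space \<Rightarrow>\<^sub>C complex) \<Rightarrow> ('h::complex_hilbert \<Rightarrow>\<^sub>L 'h)) \<Rightarrow> bool" where
  "faithful_representation \<rho> \<longleftrightarrow>
     (\<forall>f\<in>C0. \<forall>c \<xi>. blinfun_apply (\<rho> f) (c *\<^sub>C \<xi>) = c *\<^sub>C blinfun_apply (\<rho> f) \<xi>) \<and>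
     (\<forall>f\<in>C0. \<forall>g\<in>C0. \<rho> (f + g) = \<rho> f + \<rho> g) \<and>
     (\<forall>f\<in>C0. \<forall>c \<xi>. blinfun_apply (\<rho> (scaleC_fun c f)) \<xi> = c *\<^sub>C blinfun_apply (\<rho> f) \<xi>) \<and>
     (\<forall>f\<in>C0. \<forall>g\<in>C0. \<rho> (times_fun f g) = \<rho> f o\<^sub>L \<rho> g) \<and>
     (\<forall>f\<in>C0. \<forall>\<xi> \<eta>. cinner (blinfun_apply (\<rho> f) \<xi>) \<eta> = cinner \<xi> (blinfun_apply (\<rho> (cnj_fun f)) \<eta>)) \<and>
     inj_on \<rho> C0"


lemma rep_simps:
  assumes "faithful_representation \<rho>"
  shows rep_scaleC_arg: "\<And>f c \<xi>. f \<in> C0 \<Longrightarrow> blinfun_apply (\<rho> f) (c *\<^sub>C \<xi>) = c *\<^sub>C blinfun_apply (\<rho> f) \<xi>"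
    and rep_add: "\<And>f g. f \<in> C0 \<Longrightarrow> g \<in> C0 \<Longrightarrow> \<rho> (f + g) = \<rho> f + \<rho> g"
    and rep_scaleC: "\<And>f c \<xi>. f \<in> C0 \<Longrightarrow> blinfun_apply (\<rho> (scaleC_fun c f)) \<xi> = c *\<^sub>C blinfun_apply (\<rho> f) \<xi>"
    and rep_times: "\<And>f g. f \<in> C0 \<Longrightarrow> g \<in> C0 \<Longrightarrow> \<rho> (times_fun f g) = \<rho> f o\<^sub>L \<rho> g"
    and rep_cnj: "\<And>f \<xi> \<eta>. f \<in> C0 \<Longrightarrow>
      cinner (blinfun_apply (\<rho> f) \<xi>) \<eta> = cinner \<xi> (blinfun_apply (\<rho> (cnj_fun f)) \<eta>)"
    and rep_inj: "inj_on \<rho> C0"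
  using assms unfolding faithful_representation_def by - (elim conjE, metis)+

lemma apply_Bcontfun:
  fixes h :: "'a::topological_space \<Rightarrow> complex"
  assumes "continuous_on UNIV h" "\<And>x. cmod (h x) \<le> B"
  shows "apply_bcontfun (Bcontfun h) = h"
  using assms by (intro Bcontfun_inverse) (auto intro: bcontfun_normI)

lemma apply_scaleC_fun [simp]: "apply_bcontfun (scaleC_fun c f) x = c * apply_bcontfun f x"
proof -
  have "apply_bcontfun (scaleC_fun c f) = (\<lambda>x. c * apply_bcontfun f x)"
    unfolding scaleC_fun_def
    by (rule apply_Bcontfun[where B = "cmod c * norm f"])
      (auto intro!: continuous_intros mult_left_mono norm_bounded simp: norm_mult)
  then show ?thesis by simp
qed

lemma apply_times_fun [simp]:
  "apply_bcontfun (times_fun f g) x = apply_bcontfun f x * apply_bcontfun g x"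
proof -
  have "apply_bcontfun (times_fun f g) = (\<lambda>x. apply_bcontfun f x * apply_bcontfun g x)"
    unfolding times_fun_def
    by (rule apply_Bcontfun[where B = "norm f * norm g"])
      (auto intro!: continuous_intros mult_mono norm_bounded simp: norm_mult)
  then show ?thesis by simp
qed

lemma apply_cnj_fun [simp]: "apply_bcontfun (cnj_fun f) x = cnj (apply_bcontfun f x)"
proof -
  have "apply_bcontfun (cnj_fun f) = (\<lambda>x. cnj (apply_bcontfun f x))"
    unfolding cnj_fun_def
    by (rule apply_Bcontfun[where B = "norm f"]) (auto intro!: continuous_intros norm_bounded)
  then show ?thesis by simp
qed

lemma C0_dominated:
  assumes f: "f \<in> C0" and M: "M > 0"
    and le: "\<And>x. cmod (apply_bcontfun h x) \<le> M * cmod (apply_bcontfun f x)"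
  shows "h \<in> C0"
  unfolding C0_def
proof (intro CollectI allI impI)
  fix e :: real assume e: "0 < e"
  have "compact {x. e / M \<le> cmod (apply_bcontfun f x)}"
    using f e M by (simp add: C0_def)
  moreover have "closed {x. e \<le> cmod (apply_bcontfun h x)}"
    by (intro closed_Collect_le continuous_intros) auto
  ultimately have "compact ({x. e / M \<le> cmod (apply_bcontfun f x)} \<inter> {x. e \<le> cmod (apply_bcontfun h x)})"
    by (rule compact_Int_closed)
  moreover have "{x. e / M \<le> cmod (apply_bcontfun f x)} \<inter> {x. e \<le> cmod (apply_bcontfun h x)}
      = {x. e \<le> cmod (apply_bcontfun h x)}"
    using M by (auto simp: field_simps intro: order.trans[OF _ le])
  ultimately show "compact {x. e \<le> cmod (apply_bcontfun h x)}" by simp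
qed

lemma C0_zero: "0 \<in> C0"
  by (simp add: C0_def not_le)

lemma C0_scaleC: "f \<in> C0 \<Longrightarrow> scaleC_fun c f \<in> C0"
  by (rule C0_dominated[where M = "cmod c + 1"]) (auto simp: norm_mult mult_right_mono add_nonneg_pos)

lemma C0_cnj: "f \<in> C0 \<Longrightarrow> cnj_fun f \<in> C0"
  by (rule C0_dominated[where M = 1]) auto

lemma C0_times:
  assumes "f \<in> C0"
  shows "times_fun f g \<in> C0"
proof (rule C0_dominated[OF assms, where M = "norm g + 1"])
  fix x
  have "cmod (apply_bcontfun f x) * cmod (apply_bcontfun g x) \<le> cmod (apply_bcontfun f x) * (norm g + 1)"
    using norm_bounded[of g x] by (intro mult_left_mono) auto
  then show "cmod (apply_bcontfun (times_fun f g) x) \<le> (norm g + 1) * cmod (apply_bcontfun f x)"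
    by (simp add: norm_mult mult.commute)
qed (simp add: add_nonneg_pos)

lemma C0_add:
  assumes "f \<in> C0" "g \<in> C0"
  shows "f + g \<in> C0"
  unfolding C0_def
proof (intro CollectI allI impI)
  fix e :: real assume e: "0 < e"
  have "compact ({x. e / 2 \<le> cmod (apply_bcontfun f x)} \<union> {x. e / 2 \<le> cmod (apply_bcontfun g x)})"
    using assms half_gt_zero[OF e] unfolding C0_def by (intro compact_Un) blast+
  moreover have "closed {x. e \<le> cmod (apply_bcontfun (f + g) x)}"
    by (intro closed_Collect_le continuous_on_norm continuous_on_const continuous_on_apply_bcontfun)
  ultimately have "compact (({x. e / 2 \<le> cmod (apply_bcontfun f x)} \<union> {x. e / 2 \<le> cmod (apply_bcontfun g x)})
      \<inter> {x. e \<le> cmod (apply_bcontfun (f + g) x)})"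
    by (rule compact_Int_closed)
  moreover have "e / 2 \<le> cmod (apply_bcontfun f x) \<or> e / 2 \<le> cmod (apply_bcontfun g x)"
    if "e \<le> cmod (apply_bcontfun (f + g) x)" for x
    using that norm_triangle_ineq[of "apply_bcontfun f x" "apply_bcontfun g x"] by auto
  then have "({x. e / 2 \<le> cmod (apply_bcontfun f x)} \<union> {x. e / 2 \<le> cmod (apply_bcontfun g x)})
      \<inter> {x. e \<le> cmod (apply_bcontfun (f + g) x)} = {x. e \<le> cmod (apply_bcontfun (f + g) x)}"
    by auto
  ultimately show "compact {x. e \<le> cmod (apply_bcontfun (f + g) x)}" by simp
qed

lemma C0_diff:
  assumes "f \<in> C0" "g \<in> C0"
  shows "f - g \<in> C0"
proof -
  have "f - g = f + scaleC_fun (-1) g"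
    by (rule bcontfun_eqI) simp
  then show ?thesis using C0_add[OF assms(1) C0_scaleC[OF assms(2)]] by metis
qed

lemma rep_diff:
  assumes \<rho>: "faithful_representation \<rho>" and "f \<in> C0" "g \<in> C0"
  shows "\<rho> (f - g) = \<rho> f - \<rho> g"
  using rep_add[OF \<rho> C0_diff[OF assms(2,3)] assms(3)] by simp

lemma rep_norm_sq:
  assumes \<rho>: "faithful_representation \<rho>" and f: "f \<in> C0"
  shows "complex_of_real ((norm (blinfun_apply (\<rho> f) \<xi>))\<^sup>2)
    = cinner \<xi> (blinfun_apply (\<rho> (times_fun (cnj_fun f) f)) \<xi>)"
proof -
  have "complex_of_real ((norm (blinfun_apply (\<rho> f) \<xi>))\<^sup>2)
      = cinner (blinfun_apply (\<rho> f) \<xi>) (blinfun_apply (\<rho> f) \<xi>)"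
    by (simp only: cinner_self)
  also have "\<dots> = cinner \<xi> (blinfun_apply (\<rho> (cnj_fun f)) (blinfun_apply (\<rho> f) \<xi>))"
    by (rule rep_cnj[OF \<rho> f])
  also have "\<dots> = cinner \<xi> (blinfun_apply (\<rho> (times_fun (cnj_fun f) f)) \<xi>)"
    by (simp add: rep_times[OF \<rho> C0_cnj[OF f] f])
  finally show ?thesis .
qed

lemma rep_contractive_aux:
  assumes \<rho>: "faithful_representation \<rho>" and f: "f \<in> C0" and le: "norm f \<le> 1"
  shows "norm (blinfun_apply (\<rho> f) \<xi>) \<le> norm \<xi>"
proof -
  have f1: "(cmod (apply_bcontfun f x))\<^sup>2 \<le> 1" for x
    using norm_bounded[of f x] le by (simp add: power_le_one)
  define s where "s x = 1 - sqrt (1 - (cmod (apply_bcontfun f x))\<^sup>2)" for x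
  have s0: "0 \<le> s x" for x
    by (simp add: s_def)
  have s1: "s x + s x = (cmod (apply_bcontfun f x))\<^sup>2 + s x * s x" for x
    using real_sqrt_pow2[of "1 - (cmod (apply_bcontfun f x))\<^sup>2"] f1[of x]
    by (simp add: s_def power2_eq_square algebra_simps)
  have s2: "s x \<le> cmod (apply_bcontfun f x)" for x
  proof -
    have "s x \<le> 1" using f1[of x] by (simp add: s_def)
    then have "s x * s x \<le> s x" using s0[of x] by (simp add: mult_left_le)
    then have "s x \<le> (cmod (apply_bcontfun f x))\<^sup>2" using s1[of x] by linarith
    also have "\<dots> \<le> cmod (apply_bcontfun f x)"
      using norm_bounded[of f x] le by (simp add: power2_eq_square mult_left_le)
    finally show ?thesis .
  qed
  define g where "g = Bcontfun (\<lambda>x. complex_of_real (s x))"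
  have g: "apply_bcontfun g = (\<lambda>x. complex_of_real (s x))"
    unfolding g_def
  proof (rule apply_Bcontfun[where B = 1])
    show "continuous_on UNIV (\<lambda>x. complex_of_real (s x))"
      unfolding s_def by (intro continuous_intros) auto
    show "cmod (complex_of_real (s x)) \<le> 1" for x
      using s0[of x] s2[of x] norm_bounded[of f x] le by simp
  qed
  have gC: "g \<in> C0"
    by (rule C0_dominated[OF f, where M = 1]) (use s0 s2 in \<open>auto simp: g\<close>)
  define P where "P h = Re (cinner \<xi> (blinfun_apply (\<rho> h) \<xi>))" for h
  have P: "P (times_fun (cnj_fun h) h) = (norm (blinfun_apply (\<rho> h) \<xi>))\<^sup>2" if "h \<in> C0" for h
    using rep_norm_sq[OF \<rho> that, of \<xi>] unfolding P_def by (metis Re_complex_of_real)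
  have Padd: "P (h + k) = P h + P k" if "h \<in> C0" "k \<in> C0" for h k
    by (simp add: P_def rep_add[OF \<rho> that] blinfun.add_left cinner_add_right)
  have "g + g = times_fun (cnj_fun f) f + times_fun (cnj_fun g) g"
  proof (rule bcontfun_eqI)
    fix x
    have "complex_of_real (s x + s x) = complex_of_real ((cmod (apply_bcontfun f x))\<^sup>2 + s x * s x)"
      by (simp only: s1)
    then show "apply_bcontfun (g + g) x
        = apply_bcontfun (times_fun (cnj_fun f) f + times_fun (cnj_fun g) g) x"
      by (simp add: g complex_norm_square mult.commute del: of_real_power)
  qed
  then have "P g + P g = (norm (blinfun_apply (\<rho> f) \<xi>))\<^sup>2 + (norm (blinfun_apply (\<rho> g) \<xi>))\<^sup>2"
    using P f gC C0_times[OF C0_cnj] by (metis Padd)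
  moreover have "0 \<le> (norm \<xi>)\<^sup>2 - 2 * P g + (norm (blinfun_apply (\<rho> g) \<xi>))\<^sup>2"
    using zero_le_power2[of "norm (\<xi> + (-1) *\<^sub>C blinfun_apply (\<rho> g) \<xi>)"]
    by (simp add: norm_add_sq norm_scaleC cinner_scaleC_right P_def del: zero_le_power2)
  ultimately have "(norm (blinfun_apply (\<rho> f) \<xi>))\<^sup>2 \<le> (norm \<xi>)\<^sup>2"
    by linarith
  then show ?thesis
    by (simp add: abs_le_square_iff[symmetric])
qed

lemma rep_contractive:
  assumes \<rho>: "faithful_representation \<rho>" and f: "f \<in> C0"
  shows "norm (blinfun_apply (\<rho> f) \<xi>) \<le> norm f * norm \<xi>"
proof (cases "norm f = 0")
  case True
  have "\<rho> 0 = 0" using rep_add[OF \<rho> C0_zero C0_zero] by simp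
  then show ?thesis using True by simp
next
  case False
  define h where "h = scaleC_fun (complex_of_real (inverse (norm f))) f"
  have h: "h \<in> C0" unfolding h_def by (rule C0_scaleC[OF f])
  have "h = inverse (norm f) *\<^sub>R f"
    by (rule bcontfun_eqI) (simp add: h_def scaleR_conv_of_real)
  then have "norm h \<le> 1" using False by simp
  then have "norm (blinfun_apply (\<rho> h) \<xi>) \<le> norm \<xi>"
    by (rule rep_contractive_aux[OF \<rho> h])
  then show ?thesis
    using False by (simp add: h_def rep_scaleC[OF \<rho> f] norm_scaleC norm_divide divide_simps mult.commute)
qed

lemma rep_isometric:
  assumes \<rho>: "faithful_representation \<rho>" and f: "f \<in> C0"
  shows "norm (\<rho> f) = norm f"
proof (rule antisym)
  show "norm (\<rho> f) \<le> norm f"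
    by (rule norm_blinfun_bound) (use rep_contractive[OF \<rho> f] in auto)
  show "norm f \<le> norm (\<rho> f)"
  proof (rule dense_le)
    fix c assume c: "c < norm f"
    show "c \<le> norm (\<rho> f)"
    proof (cases "c < 0")
      case False
      then have c0: "0 \<le> c" by simp
      let ?m = "\<lambda>x. cmod (apply_bcontfun f x)"
      define s where "s x = max (?m x - c) 0" for x
      define t where "t x = sqrt (max ((?m x)\<^sup>2 - c\<^sup>2) 0)" for x
      define g where "g = Bcontfun (\<lambda>x. complex_of_real (s x))"
      define r where "r = Bcontfun (\<lambda>x. complex_of_real (t x))"
      have s: "0 \<le> s x" "s x \<le> ?m x" for x
        using c0 by (auto simp: s_def)
      have t: "0 \<le> t x" "t x \<le> ?m x" for x
        by (auto simp: t_def intro!: real_le_lsqrt)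
      have g: "apply_bcontfun g = (\<lambda>x. complex_of_real (s x))"
        unfolding g_def
      proof (rule apply_Bcontfun[where B = "norm f"])
        show "continuous_on UNIV (\<lambda>x. complex_of_real (s x))"
          unfolding s_def by (intro continuous_intros) auto
        show "cmod (complex_of_real (s x)) \<le> norm f" for x
          using s[of x] norm_bounded[of f x] by simp
      qed
      have r: "apply_bcontfun r = (\<lambda>x. complex_of_real (t x))"
        unfolding r_def
      proof (rule apply_Bcontfun[where B = "norm f"])
        show "continuous_on UNIV (\<lambda>x. complex_of_real (t x))"
          unfolding t_def by (intro continuous_intros) auto
        show "cmod (complex_of_real (t x)) \<le> norm f" for x
          using t[of x] norm_bounded[of f x] by simp
      qed
      have gC: "g \<in> C0"
        by (rule C0_dominated[OF f, where M = 1]) (use s in \<open>auto simp: g\<close>)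
      have "g \<noteq> 0"
      proof
        assume "g = 0"
        then have "s x = 0" for x using fun_cong[OF g, of x] by simp
        then have "?m x \<le> c" for x unfolding s_def by (metis diff_gt_0_iff_gt max.strict_order_iff max_def not_le)
        then have "norm f \<le> c" by (rule norm_bound)
        then show False using c by simp
      qed
      then have "\<rho> g \<noteq> \<rho> 0"
        using rep_inj[OF \<rho>] gC C0_zero by (auto dest: inj_onD)
      moreover have "\<rho> 0 = 0" using rep_add[OF \<rho> C0_zero C0_zero] by simp
      ultimately obtain \<xi> where \<xi>: "blinfun_apply (\<rho> g) \<xi> \<noteq> 0"
        by (metis blinfun_eqI zero_blinfun.rep_eq)
      define P where "P h = Re (cinner \<xi> (blinfun_apply (\<rho> h) \<xi>))" for h
      have P: "P (times_fun (cnj_fun h) h) = (norm (blinfun_apply (\<rho> h) \<xi>))\<^sup>2" if "h \<in> C0" for h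
        using rep_norm_sq[OF \<rho> that, of \<xi>] unfolding P_def by (metis Re_complex_of_real)
      have Padd: "P (h + k) = P h + P k" if "h \<in> C0" "k \<in> C0" for h k
        by (simp add: P_def rep_add[OF \<rho> that] blinfun.add_left cinner_add_right)
      have Psc: "P (scaleC_fun (complex_of_real d) h) = d * P h" if "h \<in> C0" for h d
        by (simp add: P_def rep_scaleC[OF \<rho> that] cinner_scaleC_right)
      let ?fg = "times_fun f g" and ?k = "times_fun g r"
      have fgC: "?fg \<in> C0" and kC: "?k \<in> C0" by (simp_all add: C0_times f gC)
      have pt: "(?m x)\<^sup>2 * (s x * s x) = (s x * t x) * (s x * t x) + c\<^sup>2 * (s x * s x)" for x
      proof (cases "?m x \<le> c")
        case True
        then show ?thesis by (simp add: s_def)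
      next
        case False
        then have "c\<^sup>2 \<le> (?m x)\<^sup>2" using c0 by (intro power_mono) auto
        then have "t x * t x = (?m x)\<^sup>2 - c\<^sup>2" by (simp add: t_def)
        then have "(s x * t x) * (s x * t x) = (s x * s x) * ((?m x)\<^sup>2 - c\<^sup>2)"
          by (metis mult.assoc mult.commute)
        then show ?thesis by (simp add: algebra_simps)
      qed
      have "times_fun (cnj_fun ?fg) ?fg
          = times_fun (cnj_fun ?k) ?k + scaleC_fun (complex_of_real (c\<^sup>2)) (times_fun (cnj_fun g) g)"
      proof (rule bcontfun_eqI)
        fix x
        have "complex_of_real ((?m x)\<^sup>2 * (s x * s x))
            = complex_of_real ((s x * t x) * (s x * t x) + c\<^sup>2 * (s x * s x))"
          by (simp only: pt)
        then show "apply_bcontfun (times_fun (cnj_fun ?fg) ?fg) x = apply_bcontfun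
            (times_fun (cnj_fun ?k) ?k + scaleC_fun (complex_of_real (c\<^sup>2)) (times_fun (cnj_fun g) g)) x"
          by (simp add: g r complex_norm_square mult_ac del: of_real_power)
      qed
      then have "(norm (blinfun_apply (\<rho> ?fg) \<xi>))\<^sup>2
          = (norm (blinfun_apply (\<rho> ?k) \<xi>))\<^sup>2 + c\<^sup>2 * (norm (blinfun_apply (\<rho> g) \<xi>))\<^sup>2"
        by (simp add: P[symmetric] fgC kC gC Padd Psc C0_times C0_cnj C0_scaleC del: of_real_power)
      then have "(c * norm (blinfun_apply (\<rho> g) \<xi>))\<^sup>2 \<le> (norm (blinfun_apply (\<rho> ?fg) \<xi>))\<^sup>2"
        by (simp add: power_mult_distrib)
      then have "c * norm (blinfun_apply (\<rho> g) \<xi>) \<le> norm (blinfun_apply (\<rho> ?fg) \<xi>)"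
        using c0 by (simp add: abs_le_square_iff[symmetric])
      also have "\<dots> \<le> norm (\<rho> f) * norm (blinfun_apply (\<rho> g) \<xi>)"
        by (simp add: rep_times[OF \<rho> f gC] norm_blinfun)
      finally show ?thesis using \<xi> by simp
    qed (use norm_ge_zero[of "\<rho> f"] in linarith)
  qed
qed


section \<open>The semicrossed product \<open>C\<^sub>0(X) \<times>\<^sub>\<phi> \<int>\<^sub>+\<close>\<close>

definition proper :: "('a::topological_space \<Rightarrow> 'a) \<Rightarrow> bool" where
  "proper \<phi> \<longleftrightarrow> (\<forall>K. compact K \<longrightarrow> compact (\<phi> -` K))"

definition alpha :: "('a \<Rightarrow> 'a) \<Rightarrow> nat \<Rightarrow> ('a::topological_space \<Rightarrow>\<^sub>C complex) \<Rightarrow> ('a \<Rightarrow>\<^sub>C complex)" where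
  "alpha \<phi> n f = Bcontfun (\<lambda>x. apply_bcontfun f ((\<phi> ^^ n) x))"

lemma apply_alpha:
  assumes "continuous_on UNIV \<phi>"
  shows "apply_bcontfun (alpha \<phi> n f) x = apply_bcontfun f ((\<phi> ^^ n) x)"
proof -
  have "continuous_on UNIV (\<phi> ^^ n)"
  proof (induction n)
    case (Suc n)
    have "continuous_on UNIV (\<phi> \<circ> (\<phi> ^^ n))"
      using Suc assms by (intro continuous_on_compose) (auto intro: continuous_on_subset)
    then show ?case by simp
  qed (simp add: continuous_on_id)
  then have "continuous_on UNIV (apply_bcontfun f \<circ> (\<phi> ^^ n))"
    by (intro continuous_on_compose) auto
  then have "apply_bcontfun (alpha \<phi> n f) = (\<lambda>x. apply_bcontfun f ((\<phi> ^^ n) x))"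
    unfolding alpha_def
    by (intro apply_Bcontfun[where B = "norm f"]) (auto simp: o_def norm_bounded)
  then show ?thesis by simp
qed

lemma C0_alpha:
  assumes \<phi>: "continuous_on UNIV \<phi>" "proper \<phi>" and f: "f \<in> C0"
  shows "alpha \<phi> n f \<in> C0"
  unfolding C0_def
proof (intro CollectI allI impI)
  fix e :: real assume e: "0 < e"
  have *: "compact ((\<phi> ^^ n) -` K)" if "compact K" for K
    using that
  proof (induction n arbitrary: K)
    case (Suc n)
    have "(\<phi> ^^ Suc n) -` K = (\<phi> ^^ n) -` (\<phi> -` K)"
      by auto
    then show ?case using Suc.IH Suc.prems \<phi>(2) unfolding proper_def by metis
  qed simp
  have "compact ((\<phi> ^^ n) -` {x. e \<le> cmod (apply_bcontfun f x)})"
    using f e by (intro *) (simp add: C0_def)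
  then show "compact {x. e \<le> cmod (apply_bcontfun (alpha \<phi> n f) x)}"
    by (simp add: apply_alpha[OF \<phi>(1)] vimage_def)
qed

lemma norm_alpha_le:
  assumes "continuous_on UNIV \<phi>"
  shows "norm (alpha \<phi> n f) \<le> norm f"
  by (rule norm_bound) (simp add: apply_alpha[OF assms] norm_bounded)

text \<open>The sequence \<open>a\<close> stands for the formal series \<open>\<Sum>n. U\<^sup>n (a n)\<close>.\<close>

definition l1C0 :: "(nat \<Rightarrow> ('a::topological_space \<Rightarrow>\<^sub>C complex)) set" where
  "l1C0 = {a. (\<forall>n. a n \<in> C0) \<and> summable (\<lambda>n. norm (a n))}"

text \<open>\<open>monomial_op \<phi> \<rho> n f\<close> is the operator \<open>\<pi>(U\<^sup>n f)\<close>, that is,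
  \<open>\<xi> \<otimes> e\<^sub>k \<mapsto> \<rho>(f \<circ> \<phi>\<^sup>k) \<xi> \<otimes> e\<^bsub>k+n\<^esub>\<close>, written in coordinates; see \<open>monomial_op_single\<close>.\<close>

definition monomial_op ::
    "('a::topological_space \<Rightarrow> 'a) \<Rightarrow> (('a \<Rightarrow>\<^sub>C complex) \<Rightarrow> ('h::complex_hilbert \<Rightarrow>\<^sub>L 'h)) \<Rightarrow>
     nat \<Rightarrow> ('a \<Rightarrow>\<^sub>C complex) \<Rightarrow> ('h ell2 \<Rightarrow>\<^sub>L 'h ell2)" where
  "monomial_op \<phi> \<rho> n f = Blinfun (\<lambda>x. Abs_ell2 (\<lambda>m.
     if n \<le> m then blinfun_apply (\<rho> (alpha \<phi> (m - n) f)) (ell2_nth x (m - n)) else 0))"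

definition l1_rep ::
    "('a::topological_space \<Rightarrow> 'a) \<Rightarrow> (('a \<Rightarrow>\<^sub>C complex) \<Rightarrow> ('h::complex_hilbert \<Rightarrow>\<^sub>L 'h)) \<Rightarrow>
     (nat \<Rightarrow> ('a \<Rightarrow>\<^sub>C complex)) \<Rightarrow> ('h ell2 \<Rightarrow>\<^sub>L 'h ell2)" where
  "l1_rep \<phi> \<rho> a = (\<Sum>n. monomial_op \<phi> \<rho> n (a n))"

lemma sums_shifted:
  fixes F :: "nat \<Rightarrow> real"
  assumes "F sums s"
  shows "(\<lambda>m. if n \<le> m then F (m - n) else 0) sums s"
proof -
  have "(\<lambda>m. (\<lambda>m. if n \<le> m then F (m - n) else 0) (m + n)) sums s"
    using assms by simp
  then show ?thesis
    using sums_iff_shift[of "\<lambda>m. if n \<le> m then F (m - n) else 0" n s] by simp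
qed

context
  fixes \<phi> :: "'a::topological_space \<Rightarrow> 'a"
    and \<rho> :: "('a \<Rightarrow>\<^sub>C complex) \<Rightarrow> ('h::complex_hilbert \<Rightarrow>\<^sub>L 'h)"
  assumes \<phi>: "continuous_on UNIV \<phi>" "proper \<phi>" and \<rho>: "faithful_representation \<rho>"
begin

lemma monomial_op_aux:
  assumes f: "f \<in> C0"
  shows "ell2_nth (blinfun_apply (monomial_op \<phi> \<rho> n f) x) m =
      (if n \<le> m then blinfun_apply (\<rho> (alpha \<phi> (m - n) f)) (ell2_nth x (m - n)) else 0)" (is ?nth)
    and "norm (monomial_op \<phi> \<rho> n f) \<le> norm f" (is ?norm)
proof -
  let ?T = "\<lambda>(x :: 'h ell2) m.
    if n \<le> m then blinfun_apply (\<rho> (alpha \<phi> (m - n) f)) (ell2_nth x (m - n)) else 0"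
  have bd: "norm (?T x m) \<le> norm f * (if n \<le> m then norm (ell2_nth x (m - n)) else 0)"
    for x :: "'h ell2" and m
    using order.trans[OF rep_contractive[OF \<rho> C0_alpha[OF \<phi> f]] mult_right_mono[OF norm_alpha_le[OF \<phi>(1)]]]
    by auto
  have sq: "(norm (?T x m))\<^sup>2 \<le> (norm f)\<^sup>2 * (if n \<le> m then (norm (ell2_nth x (m - n)))\<^sup>2 else 0)"
    for x :: "'h ell2" and m
    using power_mono[OF bd[where x = x and m = m] norm_ge_zero, of 2] by (auto simp: power_mult_distrib)
  have sm: "(\<lambda>m. (norm f)\<^sup>2 * (if n \<le> m then (norm (ell2_nth x (m - n)))\<^sup>2 else 0))
      sums ((norm f)\<^sup>2 * (norm x)\<^sup>2)" for x :: "'h ell2"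
    unfolding norm_ell2_sq by (intro sums_mult sums_shifted summable_sums summable_ell2)
  have su: "summable (\<lambda>m. (norm (?T x m))\<^sup>2)" for x
    by (rule summable_comparison_test'[OF sums_summable[OF sm[of x]], where N = 0])
      (use sq[where x = x] in simp)
  have T: "ell2_nth (Abs_ell2 (?T x)) = ?T x" for x
    using su[of x] by (intro Abs_ell2_inverse) simp
  have nm: "norm (Abs_ell2 (?T x)) \<le> norm x * norm f" for x
  proof -
    have "(norm (Abs_ell2 (?T x)))\<^sup>2 = (\<Sum>m. (norm (?T x m))\<^sup>2)"
      by (simp only: norm_ell2_sq T)
    also have "\<dots> \<le> (\<Sum>m. (norm f)\<^sup>2 * (if n \<le> m then (norm (ell2_nth x (m - n)))\<^sup>2 else 0))"
      by (rule suminf_le[OF sq su sums_summable[OF sm]])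
    also have "\<dots> = (norm x * norm f)\<^sup>2"
      using sums_unique[OF sm[of x]] by (simp add: power_mult_distrib mult.commute)
    finally show ?thesis
      by (simp add: abs_le_square_iff[symmetric])
  qed
  have "bounded_linear (\<lambda>x. Abs_ell2 (?T x))"
  proof (rule bounded_linear_intro[where K = "norm f"])
    fix x y :: "'h ell2" and r :: real
    show "Abs_ell2 (?T (x + y)) = Abs_ell2 (?T x) + Abs_ell2 (?T y)"
      by (rule ell2_eqI, unfold plus_ell2.rep_eq[of "Abs_ell2 (?T x)"] T) (simp add: blinfun.add_right)
    show "Abs_ell2 (?T (r *\<^sub>R x)) = r *\<^sub>R Abs_ell2 (?T x)"
      by (rule ell2_eqI, unfold scaleR_ell2.rep_eq[of r "Abs_ell2 (?T x)"] T) (simp add: blinfun.scaleR_right)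
  qed (rule nm)
  then have app: "blinfun_apply (monomial_op \<phi> \<rho> n f) = (\<lambda>x. Abs_ell2 (?T x))"
    unfolding monomial_op_def by (rule bounded_linear_Blinfun_apply)
  show ?nth by (simp only: app T)
  show ?norm
    by (rule norm_blinfun_bound) (use nm in \<open>simp_all add: app mult.commute\<close>)
qed

lemma monomial_op_single:
  assumes "f \<in> C0"
  shows "blinfun_apply (monomial_op \<phi> \<rho> n f) (\<xi> \<otimes>e k)
    = blinfun_apply (\<rho> (alpha \<phi> k f)) \<xi> \<otimes>e (k + n)"
  by (rule ell2_eqI) (auto simp: monomial_op_aux(1)[OF assms] ell2_single.rep_eq)

lemma summable_l1_rep:
  assumes "a \<in> l1C0"
  shows "summable (\<lambda>n. monomial_op \<phi> \<rho> n (a n))"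
proof (rule summable_comparison_test'[where N = 0])
  show "summable (\<lambda>n. norm (a n))" using assms by (simp add: l1C0_def)
  show "norm (monomial_op \<phi> \<rho> n (a n)) \<le> norm (a n)" for n
    using assms by (intro monomial_op_aux(2)) (simp add: l1C0_def)
qed

end

text \<open>The type \<open>'h ell2 \<Rightarrow>\<^sub>L 'h ell2\<close> consists of all bounded real-linear operators with the
  operator norm; \<open>\<B>(\<H>)\<close> is a norm-closed subset containing the range of \<open>l1_rep \<phi> \<rho>\<close>, so the
  closure below is the closure in \<open>\<B>(\<H>)\<close>. The product is composition \<open>(o\<^sub>L)\<close>.\<close>

definition semicrossed_product ::
    "('a::topological_space \<Rightarrow> 'a) \<Rightarrow> (('a \<Rightarrow>\<^sub>C complex) \<Rightarrow> ('h::complex_hilbert \<Rightarrow>\<^sub>L 'h)) \<Rightarrow>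
     ('h ell2 \<Rightarrow>\<^sub>L 'h ell2) set" where
  "semicrossed_product \<phi> \<rho> = closure (l1_rep \<phi> \<rho> ` l1C0)"

text \<open>The extension of \<open>E\<^sub>n\<close> from \<open>\<ell>\<^sup>1(\<int>\<^sub>+, C\<^sub>0(X))\<close> to the semicrossed product by continuity;
  see \<open>fourier_coeff_tendsto\<close> and \<open>fourier_coeff_l1_rep\<close>.\<close>

definition fourier_coeff ::
    "('a::topological_space \<Rightarrow> 'a) \<Rightarrow> (('a \<Rightarrow>\<^sub>C complex) \<Rightarrow> ('h::complex_hilbert \<Rightarrow>\<^sub>L 'h)) \<Rightarrow>
     nat \<Rightarrow> ('h ell2 \<Rightarrow>\<^sub>L 'h ell2) \<Rightarrow> ('a \<Rightarrow>\<^sub>C complex)" where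
  "fourier_coeff \<phi> \<rho> n A = (THE f. \<exists>a :: nat \<Rightarrow> nat \<Rightarrow> ('a \<Rightarrow>\<^sub>C complex).
     (\<forall>j. a j \<in> l1C0) \<and> (\<lambda>j. l1_rep \<phi> \<rho> (a j)) \<longlonglongrightarrow> A \<and> (\<lambda>j. a j n) \<longlonglongrightarrow> f)"

context
  fixes \<phi> :: "'a::topological_space \<Rightarrow> 'a"
    and \<rho> :: "('a \<Rightarrow>\<^sub>C complex) \<Rightarrow> ('h::complex_hilbert \<Rightarrow>\<^sub>L 'h)"
  assumes \<phi>: "continuous_on UNIV \<phi>" "proper \<phi>" and \<rho>: "faithful_representation \<rho>"
begin

lemma l1_rep_coeff:
  assumes a: "a \<in> l1C0"
  shows "ell2_nth (blinfun_apply (l1_rep \<phi> \<rho> a) (\<xi> \<otimes>e 0)) n = blinfun_apply (\<rho> (a n)) \<xi>"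
proof -
  have aC: "a m \<in> C0" for m using a by (simp add: l1C0_def)
  have "bounded_linear (\<lambda>x :: 'h ell2. ell2_nth x n)"
    by (rule bounded_linear_intro[where K = 1]) (simp_all add: norm_ell2_nth_le)
  from bounded_linear_compose[OF this blinfun.bounded_linear_left[of "\<xi> \<otimes>e 0"]]
  have "(\<lambda>m. ell2_nth (blinfun_apply (monomial_op \<phi> \<rho> m (a m)) (\<xi> \<otimes>e 0)) n)
      sums ell2_nth (blinfun_apply (l1_rep \<phi> \<rho> a) (\<xi> \<otimes>e 0)) n"
    unfolding l1_rep_def
    by (rule bounded_linear.sums) (rule summable_sums[OF summable_l1_rep[OF \<phi> \<rho> a]])
  moreover have "ell2_nth (blinfun_apply (monomial_op \<phi> \<rho> m (a m)) (\<xi> \<otimes>e 0)) n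
      = (if m = n then blinfun_apply (\<rho> (a m)) \<xi> else 0)" for m
    by (auto simp: monomial_op_single[OF \<phi> \<rho> aC] ell2_single.rep_eq alpha_def apply_bcontfun_inverse)
  ultimately have "(\<lambda>m. if m = n then blinfun_apply (\<rho> (a m)) \<xi> else 0)
      sums ell2_nth (blinfun_apply (l1_rep \<phi> \<rho> a) (\<xi> \<otimes>e 0)) n"
    by simp
  then show ?thesis
    using sums_single[of n "\<lambda>m. blinfun_apply (\<rho> (a m)) \<xi>"] sums_unique2 by blast
qed

lemma l1_rep_coeff_diff_le:
  assumes a: "a \<in> l1C0" and b: "b \<in> l1C0"
  shows "dist (a n) (b n) \<le> dist (l1_rep \<phi> \<rho> a) (l1_rep \<phi> \<rho> b)"
proof -
  have C: "a n \<in> C0" "b n \<in> C0" using a b by (simp_all add: l1C0_def)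
  have nsingle: "norm (\<xi> \<otimes>e 0) = norm \<xi>" for \<xi> :: 'h
  proof -
    have "(\<lambda>m. if m = 0 then (norm \<xi>)\<^sup>2 else 0) sums (norm \<xi>)\<^sup>2"
      using sums_single[of 0 "\<lambda>_. (norm \<xi>)\<^sup>2"] by simp
    moreover have "(\<lambda>m. (norm (ell2_nth (\<xi> \<otimes>e 0) m))\<^sup>2) = (\<lambda>m. if m = 0 then (norm \<xi>)\<^sup>2 else 0)"
      by (auto simp: ell2_single.rep_eq)
    ultimately have "(norm (\<xi> \<otimes>e 0))\<^sup>2 = (norm \<xi>)\<^sup>2"
      by (simp add: norm_ell2_sq sums_iff)
    then show ?thesis by (simp add: power2_eq_iff_nonneg)
  qed
  have "norm (\<rho> (a n - b n)) \<le> norm (l1_rep \<phi> \<rho> a - l1_rep \<phi> \<rho> b)"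
  proof (rule norm_blinfun_bound)
    fix \<xi>
    have "blinfun_apply (\<rho> (a n - b n)) \<xi>
        = ell2_nth (blinfun_apply (l1_rep \<phi> \<rho> a - l1_rep \<phi> \<rho> b) (\<xi> \<otimes>e 0)) n"
      by (simp add: rep_diff[OF \<rho> C] blinfun.diff_left l1_rep_coeff a b)
    also have "norm \<dots> \<le> norm (blinfun_apply (l1_rep \<phi> \<rho> a - l1_rep \<phi> \<rho> b) (\<xi> \<otimes>e 0))"
      by (rule norm_ell2_nth_le)
    also have "\<dots> \<le> norm (l1_rep \<phi> \<rho> a - l1_rep \<phi> \<rho> b) * norm (\<xi> \<otimes>e 0)"
      by (rule norm_blinfun)
    finally show "norm (blinfun_apply (\<rho> (a n - b n)) \<xi>)
        \<le> norm (l1_rep \<phi> \<rho> a - l1_rep \<phi> \<rho> b) * norm \<xi>"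
      by (simp add: nsingle)
  qed simp
  then show ?thesis
    by (simp add: rep_isometric[OF \<rho> C0_diff[OF C]] dist_norm)
qed

text \<open>\<open>fourier_coeff\<close> is well defined, and it is the continuous extension of \<open>a \<mapsto> a n\<close>.\<close>

lemma fourier_coeff_tendsto:
  assumes a: "\<And>j. a j \<in> l1C0" and lim: "(\<lambda>j. l1_rep \<phi> \<rho> (a j)) \<longlonglongrightarrow> A"
  shows "(\<lambda>j. a j n) \<longlonglongrightarrow> fourier_coeff \<phi> \<rho> n A"
proof -
  have Cau: "\<exists>N. \<forall>i\<ge>N. \<forall>j\<ge>N. dist (a i n) (a j n) < e" if e: "e > 0" for e :: real
  proof -
    obtain N where "\<forall>i\<ge>N. \<forall>j\<ge>N. dist (l1_rep \<phi> \<rho> (a i)) (l1_rep \<phi> \<rho> (a j)) < e"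
      using LIMSEQ_imp_Cauchy[OF lim] e unfolding Cauchy_def by blast
    then show ?thesis
      using l1_rep_coeff_diff_le[OF a a] le_less_trans by blast
  qed
  have "uniformly_Cauchy_on UNIV (\<lambda>j. apply_bcontfun (a j n))"
    unfolding uniformly_Cauchy_on_def
    by (metis Cau dist_fun_lt_imp_dist_val_lt)
  then obtain l where "uniform_limit UNIV (\<lambda>j. apply_bcontfun (a j n)) l sequentially"
    using Cauchy_uniformly_convergent uniformly_convergent_on_def by blast
  then obtain f where f: "(\<lambda>j. a j n) \<longlonglongrightarrow> f"
    by (rule uniform_limit_bcontfunE) simp_all
  have "fourier_coeff \<phi> \<rho> n A = f"
    unfolding fourier_coeff_def
  proof (rule the_equality)
    show "\<exists>a. (\<forall>j. a j \<in> l1C0) \<and> (\<lambda>j. l1_rep \<phi> \<rho> (a j)) \<longlonglongrightarrow> A \<and> (\<lambda>j. a j n) \<longlonglongrightarrow> f"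
      using a lim f by blast
    fix g
    assume "\<exists>b. (\<forall>j. b j \<in> l1C0) \<and> (\<lambda>j. l1_rep \<phi> \<rho> (b j)) \<longlonglongrightarrow> A \<and> (\<lambda>j. b j n) \<longlonglongrightarrow> g"
    then obtain b where b: "\<And>j. b j \<in> l1C0" "(\<lambda>j. l1_rep \<phi> \<rho> (b j)) \<longlonglongrightarrow> A" "(\<lambda>j. b j n) \<longlonglongrightarrow> g"
      by blast
    have "dist g f \<le> dist A A"
      by (rule LIMSEQ_le[OF tendsto_dist[OF b(3) f] tendsto_dist[OF b(2) lim]])
        (use l1_rep_coeff_diff_le[OF b(1) a] in blast)
    then show "g = f" by simp
  qed
  then show ?thesis using f by simp
qed

lemma fourier_coeff_l1_rep:
  assumes "a \<in> l1C0"
  shows "fourier_coeff \<phi> \<rho> n (l1_rep \<phi> \<rho> a) = a n"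
  using fourier_coeff_tendsto[of "\<lambda>_. a" "l1_rep \<phi> \<rho> a" n] assms
  by (simp add: LIMSEQ_const_iff)

end

text \<open>The ideal \<open>\<I> \<sim> {X\<^sub>n}\<close>. For \<open>X\<^sub>n = {}\<close> there is no condition on \<open>E\<^sub>n(A)\<close>.\<close>

definition assoc_ideal ::
    "('a::topological_space \<Rightarrow> 'a) \<Rightarrow> (('a \<Rightarrow>\<^sub>C complex) \<Rightarrow> ('h::complex_hilbert \<Rightarrow>\<^sub>L 'h)) \<Rightarrow>
     (nat \<Rightarrow> 'a set) \<Rightarrow> ('h ell2 \<Rightarrow>\<^sub>L 'h ell2) set" where
  "assoc_ideal \<phi> \<rho> X = {A \<in> semicrossed_product \<phi> \<rho>.
     \<forall>n. \<forall>x \<in> X n. apply_bcontfun (fourier_coeff \<phi> \<rho> n A) x = 0}"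


section \<open>Approximate units\<close>

definition directed_set :: "'i set \<Rightarrow> ('i \<Rightarrow> 'i \<Rightarrow> bool) \<Rightarrow> bool" where
  "directed_set \<Lambda> le \<longleftrightarrow> \<Lambda> \<noteq> {} \<and> (\<forall>i\<in>\<Lambda>. le i i) \<and>
     (\<forall>i\<in>\<Lambda>. \<forall>j\<in>\<Lambda>. \<forall>k\<in>\<Lambda>. le i j \<longrightarrow> le j k \<longrightarrow> le i k) \<and>
     (\<forall>i\<in>\<Lambda>. \<forall>j\<in>\<Lambda>. \<exists>k\<in>\<Lambda>. le i k \<and> le j k)"

definition net_tendsto ::
    "'i set \<Rightarrow> ('i \<Rightarrow> 'i \<Rightarrow> bool) \<Rightarrow> ('i \<Rightarrow> 'b::metric_space) \<Rightarrow> 'b \<Rightarrow> bool" where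
  "net_tendsto \<Lambda> le u l \<longleftrightarrow> (\<forall>e>0. \<exists>i\<in>\<Lambda>. \<forall>j\<in>\<Lambda>. le i j \<longrightarrow> dist (u j) l < e)"

definition right_approximate_unit ::
    "('b::real_normed_vector \<Rightarrow>\<^sub>L 'b) set \<Rightarrow> 'i set \<Rightarrow> ('i \<Rightarrow> 'i \<Rightarrow> bool) \<Rightarrow> ('i \<Rightarrow> ('b \<Rightarrow>\<^sub>L 'b)) \<Rightarrow> bool" where
  "right_approximate_unit \<A> \<Lambda> le u \<longleftrightarrow> directed_set \<Lambda> le \<and> (\<forall>i\<in>\<Lambda>. u i \<in> \<A>) \<and>
     (\<exists>r>0. \<forall>i\<in>\<Lambda>. norm (u i) \<le> r) \<and> (\<forall>a\<in>\<A>. net_tendsto \<Lambda> le (\<lambda>i. a o\<^sub>L u i) a)"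

text \<open>The index set is existentially quantified over subsets of one fixed type. This is no
  restriction, by \<open>has_right_approximate_unitI\<close>.\<close>

definition has_right_approximate_unit :: "('b::real_normed_vector \<Rightarrow>\<^sub>L 'b) set \<Rightarrow> bool" where
  "has_right_approximate_unit \<A> \<longleftrightarrow>
     (\<exists>(\<Lambda> :: (('b \<Rightarrow>\<^sub>L 'b) set \<times> nat) set) le u. right_approximate_unit \<A> \<Lambda> le u)"

lemma has_right_approximate_unitI:
  fixes \<A> :: "('b::real_normed_vector \<Rightarrow>\<^sub>L 'b) set" and \<Lambda> :: "'i set"
  assumes "right_approximate_unit \<A> \<Lambda> le u"
  shows "has_right_approximate_unit \<A>"
proof -
  have dir: "directed_set \<Lambda> le" and mem: "\<And>i. i \<in> \<Lambda> \<Longrightarrow> u i \<in> \<A>"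
    and lim: "\<And>a. a \<in> \<A> \<Longrightarrow> net_tendsto \<Lambda> le (\<lambda>i. a o\<^sub>L u i) a"
    using assms unfolding right_approximate_unit_def by simp_all
  have "\<exists>r>0. \<forall>i\<in>\<Lambda>. norm (u i) \<le> r"
    using assms unfolding right_approximate_unit_def by simp
  then obtain r where r: "r > 0" "\<forall>i\<in>\<Lambda>. norm (u i) \<le> r"
    by auto
  have le_refl: "\<forall>i\<in>\<Lambda>. le i i"
    and le_trans: "\<forall>i\<in>\<Lambda>. \<forall>j\<in>\<Lambda>. \<forall>k\<in>\<Lambda>. le i j \<longrightarrow> le j k \<longrightarrow> le i k"
    and ex_ub: "\<forall>i\<in>\<Lambda>. \<forall>j\<in>\<Lambda>. \<exists>k\<in>\<Lambda>. le i k \<and> le j k"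
    and ne: "\<Lambda> \<noteq> {}"
    using dir unfolding directed_set_def by - (elim conjE, assumption)+
  obtain i0 where i0: "i0 \<in> \<Lambda>" using ne by auto
  have ub: "\<exists>i\<in>\<Lambda>. \<forall>a\<in>F. \<forall>j\<in>\<Lambda>. le i j \<longrightarrow> dist (a o\<^sub>L u j) a < e"
    if "finite F" "F \<subseteq> \<A>" "e > 0" for F and e :: real
    using that
  proof (induction F rule: finite_induct)
    case empty
    then show ?case using i0 by blast
  next
    case (insert a F)
    then obtain i where i: "i \<in> \<Lambda>" "\<forall>a\<in>F. \<forall>j\<in>\<Lambda>. le i j \<longrightarrow> dist (a o\<^sub>L u j) a < e"
      by auto
    have "a \<in> \<A>" using insert.prems by simp
    from lim[OF this] \<open>e > 0\<close> obtain i'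
      where i': "i' \<in> \<Lambda>" "\<forall>j\<in>\<Lambda>. le i' j \<longrightarrow> dist (a o\<^sub>L u j) a < e"
      unfolding net_tendsto_def by metis
    obtain k where k: "k \<in> \<Lambda>" "le i k" "le i' k"
      using ex_ub[rule_format, OF i(1) i'(1)] by auto
    show ?case
    proof (intro bexI[OF _ k(1)] ballI impI)
      fix b j assume b: "b \<in> insert a F" and j: "j \<in> \<Lambda>" "le k j"
      have "le i j" "le i' j"
        using le_trans[rule_format, OF i(1) k(1) j(1) k(2) j(2)]
          le_trans[rule_format, OF i'(1) k(1) j(1) k(3) j(2)] by auto
      then show "dist (b o\<^sub>L u j) b < e"
        using b i(2) i'(2) j(1) by auto
    qed
  qed
  define \<Lambda>' where "\<Lambda>' = {F. finite F \<and> F \<subseteq> \<A>} \<times> (UNIV :: nat set)"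
  define le' where "le' = (\<lambda>p q :: ('b \<Rightarrow>\<^sub>L 'b) set \<times> nat. fst p \<subseteq> fst q \<and> snd p \<le> snd q)"
  have "\<forall>p\<in>\<Lambda>'. \<exists>i\<in>\<Lambda>. \<forall>a\<in>fst p. dist (a o\<^sub>L u i) a < 1 / (1 + real (snd p))"
  proof
    fix p assume "p \<in> \<Lambda>'"
    then obtain i where "i \<in> \<Lambda>" "\<forall>a\<in>fst p. \<forall>j\<in>\<Lambda>. le i j \<longrightarrow> dist (a o\<^sub>L u j) a < 1 / (1 + real (snd p))"
      using ub[of "fst p" "1 / (1 + real (snd p))"] unfolding \<Lambda>'_def by auto
    then show "\<exists>i\<in>\<Lambda>. \<forall>a\<in>fst p. dist (a o\<^sub>L u i) a < 1 / (1 + real (snd p))"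
      using le_refl by auto
  qed
  then obtain s where s: "\<And>p. p \<in> \<Lambda>' \<Longrightarrow> s p \<in> \<Lambda>"
      "\<And>p a. p \<in> \<Lambda>' \<Longrightarrow> a \<in> fst p \<Longrightarrow> dist (a o\<^sub>L u (s p)) a < 1 / (1 + real (snd p))"
    by metis
  have "right_approximate_unit \<A> \<Lambda>' le' (u \<circ> s)"
    unfolding right_approximate_unit_def
  proof (intro conjI ballI exI[of _ r])
    have "\<exists>k\<in>\<Lambda>'. le' i k \<and> le' j k" if "i \<in> \<Lambda>'" "j \<in> \<Lambda>'" for i j
      using that
      by (intro bexI[of _ "(fst i \<union> fst j, max (snd i) (snd j))"]) (auto simp: \<Lambda>'_def le'_def)
    moreover have "({}, 0) \<in> \<Lambda>'" by (simp add: \<Lambda>'_def)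
    ultimately show "directed_set \<Lambda>' le'"
      unfolding directed_set_def by (auto simp: le'_def)
    fix a assume a: "a \<in> \<A>"
    show "net_tendsto \<Lambda>' le' (\<lambda>p. a o\<^sub>L (u \<circ> s) p) a"
      unfolding net_tendsto_def
    proof (intro allI impI)
      fix e :: real assume "e > 0"
      then obtain n where n: "1 / (1 + real n) < e"
        using nat_approx_posE[of e] by (metis Suc_eq_plus1_left of_nat_Suc of_nat_add of_nat_1)
      show "\<exists>p\<in>\<Lambda>'. \<forall>q\<in>\<Lambda>'. le' p q \<longrightarrow> dist (a o\<^sub>L (u \<circ> s) q) a < e"
      proof (intro bexI[of _ "({a}, n)"] ballI impI)
        show "({a}, n) \<in> \<Lambda>'" using a by (simp add: \<Lambda>'_def)
        fix q assume q: "q \<in> \<Lambda>'" "le' ({a}, n) q"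
        then have "dist (a o\<^sub>L (u \<circ> s) q) a < 1 / (1 + real (snd q))"
          using s(2)[of q a] by (simp add: le'_def)
        also have "\<dots> \<le> 1 / (1 + real n)"
          using q by (intro divide_left_mono) (auto simp: le'_def)
        finally show "dist (a o\<^sub>L (u \<circ> s) q) a < e" using n by simp
      qed
    qed
  qed (use r mem s in auto)
  then show ?thesis
    unfolding has_right_approximate_unit_def by blast
qed

end

theory Submission
  imports Defs
begin

text \<open>If \<open>x \<in> X\<^sub>n - X\<^bsub>n+1\<^esub>\<close>, choose \<open>f\<close> in \<open>C\<^sub>0(X)\<close> with \<open>f x = 1\<close> that vanishes on \<open>X\<^bsub>n+1\<^esub>\<close>. Then
  \<open>U\<^bsup>n+1\<^esup> f\<close> lies in the ideal, and the coefficient of \<open>U\<^bsup>n+1\<^esup> f u\<close> at \<open>n + 1\<close> is \<open>f E\<^sub>0(u)\<close>. As \<open>X\<^sub>n \<subseteq> X\<^sub>0\<close>,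
  it vanishes at \<open>x\<close> for every \<open>u\<close> in the ideal, so no net \<open>U\<^bsup>n+1\<^esup> f u\<close> tends to \<open>U\<^bsup>n+1\<^esup> f\<close>.
  Conversely, if all \<open>X\<^sub>n\<close> equal \<open>S\<close>, an approximate unit of the functions in \<open>C\<^sub>0(X)\<close> that vanish on
  \<open>S\<close>, placed in degree \<open>0\<close>, works for finite sums of monomials \<open>U\<^sup>n f\<close> in the ideal. By Fejer's
  theorem these are dense in the ideal: the Cesaro means of the Fourier series of \<open>A\<close> converge to \<open>A\<close>.\<close>

section \<open>Functions vanishing at infinity\<close>

text \<open>Places Fourier coefficients in \<open>C0\<close>, as they are norm limits of
  coefficients of summable series. A superlevel set of the limit lies in one at half the height of a
  close approximant.\<close>

lemma closed_C0: "closed (C0 :: ('a::topological_space \<Rightarrow>\<^sub>C complex) set)"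
  unfolding closed_sequential_limits
proof (intro allI impI, elim conjE)
  fix g :: "nat \<Rightarrow> 'a \<Rightarrow>\<^sub>C complex" and f
  assume g: "\<forall>n. g n \<in> C0" and lim: "g \<longlonglongrightarrow> f"
  show "f \<in> C0"
    unfolding C0_def
  proof (intro CollectI allI impI)
    fix e :: real assume e: "0 < e"
    then obtain n where n: "dist (g n) f < e / 2"
      using lim metric_LIMSEQ_D[of g f "e / 2"] by auto
    have "compact {x. e / 2 \<le> cmod (apply_bcontfun (g n) x)}"
      using g half_gt_zero[OF e] unfolding C0_def by blast
    moreover have "closed {x. e \<le> cmod (apply_bcontfun f x)}"
      by (intro closed_Collect_le continuous_intros) auto
    ultimately have "compact ({x. e / 2 \<le> cmod (apply_bcontfun (g n) x)}
        \<inter> {x. e \<le> cmod (apply_bcontfun f x)})"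
      by (rule compact_Int_closed)
    moreover have "e / 2 \<le> cmod (apply_bcontfun (g n) x)"
      if "e \<le> cmod (apply_bcontfun f x)" for x
    proof -
      have "dist (apply_bcontfun (g n) x) (apply_bcontfun f x) < e / 2"
        using dist_bounded[of "g n" x f] n by linarith
      then show ?thesis
        using that norm_triangle_ineq2[of "apply_bcontfun f x" "apply_bcontfun (g n) x"]
        by (simp add: dist_norm norm_minus_commute)
    qed
    then have "{x. e / 2 \<le> cmod (apply_bcontfun (g n) x)} \<inter> {x. e \<le> cmod (apply_bcontfun f x)}
        = {x. e \<le> cmod (apply_bcontfun f x)}"
      by auto
    ultimately show "compact {x. e \<le> cmod (apply_bcontfun f x)}" by simp
  qed
qed

lemma scaleR_eq_scaleC_fun: "r *\<^sub>R f = scaleC_fun (complex_of_real r) f"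
  by (rule bcontfun_eqI) (simp add: scaleR_conv_of_real)

lemma C0_scaleR: "f \<in> C0 \<Longrightarrow> r *\<^sub>R f \<in> C0"
  by (simp add: scaleR_eq_scaleC_fun C0_scaleC)

text \<open>The sum of the moduli dominates every member of \<open>G\<close> and vanishes where all
  of them vanish; a common approximate unit is built from it.\<close>

lemma C0_sum_cmod:
  assumes "finite G" "G \<subseteq> C0"
  shows "\<exists>h\<in>C0. \<forall>x. apply_bcontfun h x = complex_of_real (\<Sum>g\<in>G. cmod (apply_bcontfun g x))"
  using assms
proof (induction G rule: finite_induct)
  case empty
  show ?case by (rule bexI[OF _ C0_zero]) simp
next
  case (insert g G)
  then obtain h where h: "h \<in> C0"
    "\<And>x. apply_bcontfun h x = complex_of_real (\<Sum>g\<in>G. cmod (apply_bcontfun g x))"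
    by auto
  define a where "a = Bcontfun (\<lambda>x. complex_of_real (cmod (apply_bcontfun g x)))"
  have a: "apply_bcontfun a = (\<lambda>x. complex_of_real (cmod (apply_bcontfun g x)))"
    unfolding a_def
    by (rule apply_Bcontfun[where B = "norm g"]) (auto intro!: continuous_intros norm_bounded)
  have "a \<in> C0"
    by (rule C0_dominated[of g 1]) (use insert.prems in \<open>auto simp: a\<close>)
  then show ?case
    using insert.hyps by (intro bexI[OF _ C0_add[OF \<open>a \<in> C0\<close> h(1)]]) (simp add: a h(2))
qed

text \<open>With \<open>s\<close> the sum of the moduli, \<open>e = s / (d + s)\<close> satisfies
  \<open>|g e - g| = |g| d / (d + s) <= d\<close>, since \<open>|g| <= s\<close>. It inherits the
  common zeros of \<open>G\<close>.\<close>

lemma C0_approximate_unit: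
  assumes G: "finite G" "G \<subseteq> C0" and S: "\<And>g x. g \<in> G \<Longrightarrow> x \<in> S \<Longrightarrow> apply_bcontfun g x = 0"
    and d: "d > 0"
  obtains e where "e \<in> C0" "norm e \<le> 1" "\<And>x. x \<in> S \<Longrightarrow> apply_bcontfun e x = 0"
    "\<And>g. g \<in> G \<Longrightarrow> norm (times_fun g e - g) \<le> d"
proof -
  obtain h where h: "h \<in> C0"
    "\<And>x. apply_bcontfun h x = complex_of_real (\<Sum>g\<in>G. cmod (apply_bcontfun g x))"
    using C0_sum_cmod[OF G] by blast
  define s where "s x = (\<Sum>g\<in>G. cmod (apply_bcontfun g x))" for x
  have s0: "0 \<le> s x" for x
    by (simp add: s_def sum_nonneg)
  have hs: "apply_bcontfun h x = complex_of_real (s x)" for x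
    by (simp add: h(2) s_def)
  define e where "e = Bcontfun (\<lambda>x. complex_of_real (s x / (d + s x)))"
  have pos: "d + s x > 0" for x using s0[of x] d by linarith
  have frac: "\<bar>s x / (d + s x)\<bar> \<le> 1" for x
    using pos[of x] s0[of x] d by (simp add: field_simps)
  have e: "apply_bcontfun e = (\<lambda>x. complex_of_real (s x / (d + s x)))"
    unfolding e_def
  proof (rule apply_Bcontfun[where B = 1])
    have "continuous_on UNIV s"
      unfolding s_def by (intro continuous_intros) auto
    moreover have "d + s x \<noteq> 0" for x using pos[of x] by simp
    ultimately show "continuous_on UNIV (\<lambda>x. complex_of_real (s x / (d + s x)))"
      by (intro continuous_intros) auto
    show "cmod (complex_of_real (s x / (d + s x))) \<le> 1" for x
      unfolding norm_of_real by (rule frac)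
  qed
  show thesis
  proof
    show "e \<in> C0"
    proof (rule C0_dominated[OF h(1), where M = "1 / d"])
      fix x
      have "s x / (d + s x) \<le> s x / d"
        using s0[of x] d by (intro divide_left_mono) auto
      then show "cmod (apply_bcontfun e x) \<le> 1 / d * cmod (apply_bcontfun h x)"
        using s0[of x] pos[of x] unfolding e hs norm_of_real by simp
    qed (use d in simp)
    show "norm e \<le> 1"
      by (rule norm_bound) (simp only: e norm_of_real frac)
    show "apply_bcontfun e x = 0" if "x \<in> S" for x
      using S[OF _ that] by (simp add: e s_def)
    show "norm (times_fun g e - g) \<le> d" if g: "g \<in> G" for g
    proof (rule norm_bound)
      fix x
      have le: "cmod (apply_bcontfun g x) \<le> s x"
        unfolding s_def using g G(1) by (intro member_le_sum) auto
      have "apply_bcontfun (times_fun g e - g) x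
          = apply_bcontfun g x * complex_of_real (s x / (d + s x) - 1)"
        by (simp add: e algebra_simps)
      also have "s x / (d + s x) - 1 = - (d / (d + s x))"
        using pos[of x] by (simp add: field_simps)
      finally have "cmod (apply_bcontfun (times_fun g e - g) x)
          = cmod (apply_bcontfun g x) * (d / (d + s x))"
        using pos[of x] d by (simp only: norm_mult norm_of_real) simp
      also have "\<dots> \<le> s x * (d / (d + s x))"
        using le d pos[of x] by (intro mult_right_mono) auto
      also have "\<dots> \<le> d"
        using pos[of x] d s0[of x] by (simp add: field_simps)
      finally show "cmod (apply_bcontfun (times_fun g e - g) x) \<le> d" .
    qed
  qed
qed

text \<open>Complete regularity is applied to \<open>C\<close> enlarged by the complement of a
  neighbourhood \<open>U\<close> of \<open>x\<close> inside a compact \<open>K\<close>. Then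
  \<open>f = 1 - h\<close> also vanishes outside \<open>K\<close>, which gives membership in
  \<open>C0\<close>.\<close>

lemma C0_Urysohn:
  fixes C :: "'a::t2_space set"
  assumes lc: "locally_compact_space (euclidean :: 'a topology)" and C: "closed C" and x: "x \<notin> C"
  obtains f where "f \<in> C0" "apply_bcontfun f x = 1" "\<And>y. y \<in> C \<Longrightarrow> apply_bcontfun f y = 0"
proof -
  obtain U K where UK: "open U" "compact K" "x \<in> U" "U \<subseteq> K"
    using lc unfolding locally_compact_space_def by simp blast
  have "Hausdorff_space (euclidean :: 'a topology)"
    unfolding Hausdorff_space_def disjnt_def by (metis hausdorff open_openin)
  then have "completely_regular_space (euclidean :: 'a topology)"
    using lc by (simp add: locally_compact_regular_imp_completely_regular_space)
  moreover have "closedin euclidean (C \<union> - U)"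
    using C UK by (simp add: closed_Un closed_Compl)
  ultimately obtain h :: "'a \<Rightarrow> real" where
    h: "continuous_map euclidean (top_of_set {0..1}) h" "h x = 0" "h ` (C \<union> - U) \<subseteq> {1}"
    using x UK(3) unfolding completely_regular_space_def
    by (metis DiffI UNIV_I UnE ComplD topspace_euclidean)
  have cont: "continuous_on UNIV h" and range: "\<And>y. h y \<in> {0..1}"
    using h(1) by (auto simp: continuous_map_in_subtopology)
  define f where "f = Bcontfun (\<lambda>y. complex_of_real (1 - h y))"
  have f: "apply_bcontfun f = (\<lambda>y. complex_of_real (1 - h y))"
    unfolding f_def
  proof (rule apply_Bcontfun[where B = 1])
    show "continuous_on UNIV (\<lambda>y. complex_of_real (1 - h y))"
      by (intro continuous_intros cont)
    show "cmod (complex_of_real (1 - h y)) \<le> 1" for y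
      using range[of y] unfolding norm_of_real by auto
  qed
  have out: "h y = 1" if "y \<in> C \<union> - U" for y using h(3) that by blast
  show thesis
  proof
    show "f \<in> C0"
      unfolding C0_def
    proof (intro CollectI allI impI)
      fix e :: real assume e: "0 < e"
      have "closed {y. e \<le> cmod (apply_bcontfun f y)}"
        by (intro closed_Collect_le continuous_intros) auto
      with UK(2) have "compact (K \<inter> {y. e \<le> cmod (apply_bcontfun f y)})"
        by (rule compact_Int_closed)
      moreover have "{y. e \<le> cmod (apply_bcontfun f y)} \<subseteq> K"
        using out UK(4) e by (force simp: f)
      ultimately show "compact {y. e \<le> cmod (apply_bcontfun f y)}"
        by (simp add: Int_absorb1)
    qed
  qed (use h(2) out in \<open>auto simp: f\<close>)
qed


section \<open>Compressions of square-summable sequences\<close>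

lift_definition ell2_restrict :: "nat set \<Rightarrow> 'h::real_normed_vector ell2 \<Rightarrow> 'h ell2"
  is "\<lambda>S x n. if n \<in> S then x n else 0"
  by (erule summable_comparison_test'[where N = 0]) simp

lemma norm_ell2_restrict_sq:
  assumes "finite S"
  shows "(norm (ell2_restrict S x))\<^sup>2 = (\<Sum>k\<in>S. (norm (ell2_nth x k))\<^sup>2)"
proof -
  have "(norm (ell2_restrict S x))\<^sup>2 = (\<Sum>k. if k \<in> S then (norm (ell2_nth x k))\<^sup>2 else 0)"
    unfolding norm_ell2_sq ell2_restrict.rep_eq by (intro suminf_cong) simp
  also have "\<dots> = (\<Sum>k\<in>S. (norm (ell2_nth x k))\<^sup>2)"
    using suminf_finite[OF assms, of "\<lambda>k. if k \<in> S then (norm (ell2_nth x k))\<^sup>2 else 0"] by simp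
  finally show ?thesis .
qed

lemma norm_ell2_le:
  assumes "\<And>M. (\<Sum>m<M. (norm (ell2_nth x m))\<^sup>2) \<le> B\<^sup>2" "0 \<le> B"
  shows "norm x \<le> B"
proof -
  have "(norm x)\<^sup>2 \<le> B\<^sup>2"
    unfolding norm_ell2_sq by (rule suminf_le_const[OF summable_ell2 assms(1)])
  then show ?thesis using assms(2) by (simp add: abs_le_square_iff[symmetric])
qed

text \<open>Double counting: \<open>k\<close> belongs to the window of \<open>j\<close> exactly when
  \<open>j\<close> is one of the \<open>N\<close> numbers from \<open>k\<close> to
  \<open>k + N - 1\<close>, so each squared norm is counted at most \<open>N\<close> times.\<close>

lemma sum_norm_windows_le:
  "(\<Sum>j<J. (norm (ell2_restrict {k. k \<le> j \<and> j < k + N} x))\<^sup>2) \<le> real N * (norm x)\<^sup>2"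
proof -
  let ?f = "\<lambda>k. (norm (ell2_nth x k))\<^sup>2"
  have "(\<Sum>j<J. (norm (ell2_restrict {k. k \<le> j \<and> j < k + N} x))\<^sup>2)
      = (\<Sum>j<J. \<Sum>k<J. if k \<le> j \<and> j < k + N then ?f k else 0)"
  proof (rule sum.cong[OF refl])
    fix j assume j: "j \<in> {..<J}"
    have "finite {k. k \<le> j \<and> j < k + N}" by (rule finite_subset[of _ "{..j}"]) auto
    then have "(norm (ell2_restrict {k. k \<le> j \<and> j < k + N} x))\<^sup>2
        = sum ?f {k. k \<le> j \<and> j < k + N}"
      by (rule norm_ell2_restrict_sq)
    \<comment> \<open>Window indices satisfy \<open>k \<le> j < J\<close>, so \<open>k\<close> may
      range below \<open>J\<close> for every \<open>j\<close>; the double sum becomes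
      rectangular.\<close>
    also have "\<dots> = sum ?f {k \<in> {..<J}. k \<le> j \<and> j < k + N}"
      using j by (intro sum.cong[OF _ refl]) auto
    also have "\<dots> = (\<Sum>k<J. if k \<le> j \<and> j < k + N then ?f k else 0)"
      by (rule sum.inter_filter) simp
    finally show "(norm (ell2_restrict {k. k \<le> j \<and> j < k + N} x))\<^sup>2
        = (\<Sum>k<J. if k \<le> j \<and> j < k + N then ?f k else 0)" .
  qed
  also have "\<dots> = (\<Sum>k<J. \<Sum>j<J. if k \<le> j \<and> j < k + N then ?f k else 0)"
    by (rule sum.swap)
  also have "\<dots> \<le> (\<Sum>k<J. real N * ?f k)"
  proof (rule sum_mono)
    fix k
    have "(\<Sum>j<J. if k \<le> j \<and> j < k + N then ?f k else 0) = (\<Sum>j | j \<in> {..<J} \<and> k \<le> j \<and> j < k + N. ?f k)"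
      by (rule sum.inter_filter[symmetric]) simp
    also have "\<dots> \<le> (\<Sum>j\<in>{k..<k + N}. ?f k)"
      by (rule sum_mono2) auto
    finally show "(\<Sum>j<J. if k \<le> j \<and> j < k + N then ?f k else 0) \<le> real N * ?f k"
      by simp
  qed
  also have "\<dots> \<le> real N * (norm x)\<^sup>2"
    unfolding sum_distrib_left[symmetric] by (intro mult_left_mono ell2_partial_le) simp
  finally show ?thesis .
qed


section \<open>Operators with a Fourier matrix\<close>

lemma alpha_diff:
  assumes "continuous_on UNIV \<phi>"
  shows "alpha \<phi> n (f - g) = alpha \<phi> n f - alpha \<phi> n g"
  by (rule bcontfun_eqI) (simp add: apply_alpha[OF assms])

lemma alpha_scaleR:
  assumes "continuous_on UNIV \<phi>"
  shows "alpha \<phi> n (r *\<^sub>R f) = r *\<^sub>R alpha \<phi> n f"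
  by (rule bcontfun_eqI) (simp add: apply_alpha[OF assms])

lemma alpha_times_fun:
  assumes "continuous_on UNIV \<phi>"
  shows "alpha \<phi> n (times_fun f g) = times_fun (alpha \<phi> n f) (alpha \<phi> n g)"
  by (rule bcontfun_eqI) (simp add: apply_alpha[OF assms])

lemma alpha_0 [simp]: "alpha \<phi> 0 f = f"
  by (simp add: alpha_def apply_bcontfun_inverse)

lemma rep_scaleR:
  assumes "faithful_representation \<rho>" "f \<in> C0"
  shows "\<rho> (r *\<^sub>R f) = r *\<^sub>R \<rho> f"
  by (rule blinfun_eqI)
    (simp add: scaleR_eq_scaleC_fun rep_scaleC[OF assms] scaleR_eq_scaleC blinfun.scaleR_left)

text \<open>The operator \<open>B\<close> has the lower triangular matrix of the formal series \<open>\<Sum>n. U\<^sup>n (a n)\<close>.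
  Unlike \<open>l1_rep\<close>, this makes sense without summability of the norms of the coefficients.\<close>

definition fourier_matrix ::
    "('a::topological_space \<Rightarrow> 'a) \<Rightarrow> (('a \<Rightarrow>\<^sub>C complex) \<Rightarrow> ('h::complex_hilbert \<Rightarrow>\<^sub>L 'h)) \<Rightarrow>
     ('h ell2 \<Rightarrow>\<^sub>L 'h ell2) \<Rightarrow> (nat \<Rightarrow> ('a \<Rightarrow>\<^sub>C complex)) \<Rightarrow> bool" where
  "fourier_matrix \<phi> \<rho> B a \<longleftrightarrow> (\<forall>n. a n \<in> C0) \<and>
     (\<forall>x m. ell2_nth (blinfun_apply B x) m =
        (\<Sum>n\<le>m. blinfun_apply (\<rho> (alpha \<phi> (m - n) (a n))) (ell2_nth x (m - n))))"

lemma fourier_matrix_C0: "fourier_matrix \<phi> \<rho> B a \<Longrightarrow> a n \<in> C0"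
  by (simp add: fourier_matrix_def)

lemma fourier_matrix_nth:
  "fourier_matrix \<phi> \<rho> B a \<Longrightarrow> ell2_nth (blinfun_apply B x) m =
     (\<Sum>n\<le>m. blinfun_apply (\<rho> (alpha \<phi> (m - n) (a n))) (ell2_nth x (m - n)))"
  by (simp add: fourier_matrix_def)

lemma fourier_matrix_unique:
  assumes "fourier_matrix \<phi> \<rho> A a" "fourier_matrix \<phi> \<rho> B a"
  shows "A = B"
  by (intro blinfun_eqI ell2_eqI)
    (simp only: fourier_matrix_nth[OF assms(1)] fourier_matrix_nth[OF assms(2)])

text \<open>Column \<open>0\<close> of the matrix carries no power of \<open>\<phi>\<close>, so it
  returns the coefficients themselves.\<close>

lemma fourier_matrix_single:
  assumes "fourier_matrix \<phi> \<rho> B a"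
  shows "ell2_nth (blinfun_apply B (\<xi> \<otimes>e 0)) n = blinfun_apply (\<rho> (a n)) \<xi>"
proof -
  have "ell2_nth (blinfun_apply B (\<xi> \<otimes>e 0)) n
      = (\<Sum>k\<le>n. if k = n then blinfun_apply (\<rho> (a k)) \<xi> else 0)"
    unfolding fourier_matrix_nth[OF assms] by (intro sum.cong) (auto simp: ell2_single.rep_eq)
  then show ?thesis by simp
qed

lemma norm_ell2_single [simp]: "norm (\<xi> \<otimes>e k) = norm \<xi>"
proof -
  have "(norm (\<xi> \<otimes>e k))\<^sup>2 = (\<Sum>m. if m = k then (norm \<xi>)\<^sup>2 else 0)"
    unfolding norm_ell2_sq ell2_single.rep_eq by (intro suminf_cong) simp
  also have "\<dots> = (norm \<xi>)\<^sup>2"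
    using sums_single[of k "\<lambda>_. (norm \<xi>)\<^sup>2"] by (simp add: sums_iff)
  finally show ?thesis by (simp add: power2_eq_iff_nonneg)
qed

lemma bounded_linear_ell2_nth: "bounded_linear (\<lambda>x. ell2_nth x n)"
  by (rule bounded_linear_intro[where K = 1]) (simp_all add: norm_ell2_nth_le)

text \<open>The coefficient \<open>(N - n) / N\<close> is the number of windows \<open>{k. k \<le> j \<and> j < k + N}\<close> containing both \<open>m\<close>
  and \<open>m - n\<close>, divided by \<open>N\<close>. So the Cesaro mean of order \<open>N\<close> of an operator is \<open>1 / N\<close> times the sum
  of its compressions to these windows, and as every index lies in exactly \<open>N\<close> of them, it is contractive.\<close>

lemma cesaro_mean_contractive:
  fixes B S :: "'h::complex_hilbert ell2 \<Rightarrow>\<^sub>L 'h ell2"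
  assumes B: "fourier_matrix \<phi> \<rho> B a"
    and S: "fourier_matrix \<phi> \<rho> S (\<lambda>n. (real (N - n) / real N) *\<^sub>R a n)"
    and N: "N > 0" and \<phi>: "continuous_on UNIV \<phi>" "proper \<phi>" and \<rho>: "faithful_representation \<rho>"
  shows "norm S \<le> norm B"
proof (rule norm_blinfun_bound)
  fix x :: "'h ell2"
  define Q where "Q j = ell2_restrict {k. k \<le> j \<and> j < k + N} x" for j
  have aC: "alpha \<phi> k (a n) \<in> C0" for k n
    by (rule C0_alpha[OF \<phi> fourier_matrix_C0[OF B]])
  \<comment> \<open>Restricting \<open>j\<close> to \<open>{m..<m + N}\<close> is the compression on
    the output side; \<open>Q j\<close> is the compression on the input side.\<close>
  have windows: "real N *\<^sub>R ell2_nth (blinfun_apply S x) m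
      = (\<Sum>j\<in>{m..<m + N}. ell2_nth (blinfun_apply B (Q j)) m)" for m
  proof -
    let ?v = "\<lambda>n. blinfun_apply (\<rho> (alpha \<phi> (m - n) (a n))) (ell2_nth x (m - n))"
    have "(\<Sum>j\<in>{m..<m + N}. ell2_nth (blinfun_apply B (Q j)) m)
        = (\<Sum>j\<in>{m..<m + N}. \<Sum>n\<le>m. if m - n \<le> j \<and> j < m - n + N then ?v n else 0)"
      unfolding fourier_matrix_nth[OF B]
      by (intro sum.cong refl) (simp add: Q_def ell2_restrict.rep_eq)
    also have "\<dots> = (\<Sum>n\<le>m. \<Sum>j\<in>{m..<m + N}. if m - n \<le> j \<and> j < m - n + N then ?v n else 0)"
      by (rule sum.swap)
    also have "\<dots> = (\<Sum>n\<le>m. real (N - n) *\<^sub>R ?v n)"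
    proof (rule sum.cong[OF refl])
      fix n assume n: "n \<in> {..m}"
      have "(\<Sum>j\<in>{m..<m + N}. if m - n \<le> j \<and> j < m - n + N then ?v n else 0)
          = (\<Sum>j | j \<in> {m..<m + N} \<and> m - n \<le> j \<and> j < m - n + N. ?v n)"
        by (rule sum.inter_filter[symmetric]) simp
      \<comment> \<open>As \<open>n \<le> m\<close>, this interval has \<open>N - n\<close>
        elements; truncated subtraction correctly gives none for \<open>n \<ge> N\<close>.\<close>
      also have "{j. j \<in> {m..<m + N} \<and> m - n \<le> j \<and> j < m - n + N} = {m..<m - n + N}"
        by auto
      also have "(\<Sum>j\<in>{m..<m - n + N}. ?v n) = real (N - n) *\<^sub>R ?v n"
        using n by (simp add: sum_constant_scaleR)
      finally show "(\<Sum>j\<in>{m..<m + N}. if m - n \<le> j \<and> j < m - n + N then ?v n else 0)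
          = real (N - n) *\<^sub>R ?v n" .
    qed
    also have "\<dots> = real N *\<^sub>R ell2_nth (blinfun_apply S x) m"
      unfolding fourier_matrix_nth[OF S] scaleR_sum_right alpha_scaleR[OF \<phi>(1)]
        rep_scaleR[OF \<rho> aC] blinfun.scaleR_left
      using N by simp
    finally show ?thesis by simp
  qed
  \<comment> \<open>Cauchy-Schwarz against the constant \<open>1\<close>; the number of windows
    costs a factor \<open>N\<close>.\<close>
  have cs: "(norm (\<Sum>j\<in>{m..<m + N}. y j))\<^sup>2 \<le> real N * (\<Sum>j\<in>{m..<m + N}. (norm (y j))\<^sup>2)"
    for m and y :: "nat \<Rightarrow> 'h"
  proof -
    have "(norm (\<Sum>j\<in>{m..<m + N}. y j))\<^sup>2 \<le> (\<Sum>j\<in>{m..<m + N}. norm (y j))\<^sup>2"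
      by (intro power_mono norm_sum) simp
    also have "\<dots> \<le> (\<Sum>j\<in>{m..<m + N}. (norm (y j))\<^sup>2) * (\<Sum>j\<in>{m..<m + N}. 1\<^sup>2)"
      using Cauchy_Schwarz_ineq_sum[of "\<lambda>j. norm (y j)" "\<lambda>_. 1" "{m..<m + N}"] by simp
    finally show ?thesis by (simp add: mult.commute)
  qed
  show "norm (blinfun_apply S x) \<le> norm B * norm x"
  proof (rule norm_ell2_le)
    fix M
    have "(real N)\<^sup>2 * (\<Sum>m<M. (norm (ell2_nth (blinfun_apply S x) m))\<^sup>2)
        = (\<Sum>m<M. (norm (real N *\<^sub>R ell2_nth (blinfun_apply S x) m))\<^sup>2)"
      by (simp add: sum_distrib_left power_mult_distrib)
    also have "\<dots> \<le> (\<Sum>m<M. real N * (\<Sum>j\<in>{m..<m + N}. (norm (ell2_nth (blinfun_apply B (Q j)) m))\<^sup>2))"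
      unfolding windows by (intro sum_mono cs)
    \<comment> \<open>For \<open>m < M\<close> all these windows have \<open>j < M + N\<close>; a
      range independent of \<open>m\<close> allows the sums to be swapped.\<close>
    also have "\<dots> \<le> (\<Sum>m<M. real N * (\<Sum>j<M + N. (norm (ell2_nth (blinfun_apply B (Q j)) m))\<^sup>2))"
      by (intro sum_mono mult_left_mono sum_mono2) auto
    also have "\<dots> = real N * (\<Sum>j<M + N. \<Sum>m<M. (norm (ell2_nth (blinfun_apply B (Q j)) m))\<^sup>2)"
      unfolding sum_distrib_left[symmetric] by (subst sum.swap) simp
    also have "\<dots> \<le> real N * (\<Sum>j<M + N. (norm B)\<^sup>2 * (norm (Q j))\<^sup>2)"
    proof (intro mult_left_mono sum_mono)
      fix j
      have "(\<Sum>m<M. (norm (ell2_nth (blinfun_apply B (Q j)) m))\<^sup>2) \<le> (norm (blinfun_apply B (Q j)))\<^sup>2"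
        by (rule ell2_partial_le)
      also have "\<dots> \<le> (norm B * norm (Q j))\<^sup>2"
        by (intro power_mono norm_blinfun) simp
      finally show "(\<Sum>m<M. (norm (ell2_nth (blinfun_apply B (Q j)) m))\<^sup>2) \<le> (norm B)\<^sup>2 * (norm (Q j))\<^sup>2"
        by (simp add: power_mult_distrib)
    qed simp
    \<comment> \<open>The overlap of the windows gives a second factor \<open>N\<close>; with the
      one from Cauchy-Schwarz it cancels the square on the left.\<close>
    also have "\<dots> \<le> real N * ((norm B)\<^sup>2 * (real N * (norm x)\<^sup>2))"
      unfolding sum_distrib_left[symmetric] Q_def
      by (intro mult_left_mono sum_norm_windows_le) auto
    also have "\<dots> = (real N)\<^sup>2 * (norm B * norm x)\<^sup>2"
      by (simp add: power2_eq_square)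
    finally show "(\<Sum>m<M. (norm (ell2_nth (blinfun_apply S x) m))\<^sup>2) \<le> (norm B * norm x)\<^sup>2"
      using N by simp
  qed simp
qed simp

section \<open>Matrices and coefficients of elements of the semicrossed product\<close>

context
  fixes \<phi> :: "'a::topological_space \<Rightarrow> 'a"
    and \<rho> :: "('a \<Rightarrow>\<^sub>C complex) \<Rightarrow> ('h::complex_hilbert \<Rightarrow>\<^sub>L 'h)"
  assumes \<phi>: "continuous_on UNIV \<phi>" "proper \<phi>" and \<rho>: "faithful_representation \<rho>"
begin

lemma fourier_matrix_diff:
  assumes A: "fourier_matrix \<phi> \<rho> A a" and B: "fourier_matrix \<phi> \<rho> B b"
  shows "fourier_matrix \<phi> \<rho> (A - B) (\<lambda>n. a n - b n)"
proof -
  have C: "alpha \<phi> k (a n) \<in> C0" "alpha \<phi> k (b n) \<in> C0" for k n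
    using C0_alpha[OF \<phi>] fourier_matrix_C0[OF A] fourier_matrix_C0[OF B] by auto
  show ?thesis
    unfolding fourier_matrix_def
  proof (intro conjI allI)
    show "a n - b n \<in> C0" for n
      using C0_diff fourier_matrix_C0[OF A] fourier_matrix_C0[OF B] by blast
    show "ell2_nth (blinfun_apply (A - B) x) m =
        (\<Sum>n\<le>m. blinfun_apply (\<rho> (alpha \<phi> (m - n) (a n - b n))) (ell2_nth x (m - n)))" for x m
      by (simp add: blinfun.diff_left fourier_matrix_nth[OF A] fourier_matrix_nth[OF B]
          alpha_diff[OF \<phi>(1)] rep_diff[OF \<rho> C] sum_subtractf)
  qed
qed

text \<open>Taking coordinate \<open>m\<close> is continuous, so it passes through the series;
  monomials of degree above \<open>m\<close> contribute nothing there, and a finite sum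
  remains.\<close>

lemma fourier_matrix_l1_rep:
  assumes a: "a \<in> l1C0"
  shows "fourier_matrix \<phi> \<rho> (l1_rep \<phi> \<rho> a) a"
  unfolding fourier_matrix_def
proof (intro conjI allI)
  show aC: "a n \<in> C0" for n using a by (simp add: l1C0_def)
  fix x :: "'h ell2" and m
  from bounded_linear_compose[OF bounded_linear_ell2_nth blinfun.bounded_linear_left[of x]]
  have "(\<lambda>n. ell2_nth (blinfun_apply (monomial_op \<phi> \<rho> n (a n)) x) m)
      sums ell2_nth (blinfun_apply (l1_rep \<phi> \<rho> a) x) m"
    unfolding l1_rep_def
    by (rule bounded_linear.sums) (rule summable_sums[OF summable_l1_rep[OF \<phi> \<rho> a]])
  moreover have "(\<lambda>n. ell2_nth (blinfun_apply (monomial_op \<phi> \<rho> n (a n)) x) m) sums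
      (\<Sum>n\<le>m. ell2_nth (blinfun_apply (monomial_op \<phi> \<rho> n (a n)) x) m)"
    by (rule sums_finite) (auto simp: monomial_op_aux(1)[OF \<phi> \<rho> aC])
  ultimately have "ell2_nth (blinfun_apply (l1_rep \<phi> \<rho> a) x) m =
      (\<Sum>n\<le>m. ell2_nth (blinfun_apply (monomial_op \<phi> \<rho> n (a n)) x) m)"
    by (rule sums_unique2)
  then show "ell2_nth (blinfun_apply (l1_rep \<phi> \<rho> a) x) m =
      (\<Sum>n\<le>m. blinfun_apply (\<rho> (alpha \<phi> (m - n) (a n))) (ell2_nth x (m - n)))"
    by (simp add: monomial_op_aux(1)[OF \<phi> \<rho> aC])
qed

text \<open>The matrix determines the operator, so \<open>B\<close> is the norm-convergent series of
  its monomials and the triangle inequality applies. This turns bounds on coefficients into bounds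
  on operators.\<close>

lemma norm_fourier_matrix_le:
  assumes "fourier_matrix \<phi> \<rho> B b" "summable (\<lambda>n. norm (b n))"
  shows "norm B \<le> (\<Sum>n. norm (b n))"
proof -
  have b: "b \<in> l1C0"
    using assms fourier_matrix_C0 by (auto simp: l1C0_def)
  have "B = l1_rep \<phi> \<rho> b"
    by (rule fourier_matrix_unique[OF assms(1) fourier_matrix_l1_rep[OF b]])
  also have "norm \<dots> \<le> (\<Sum>n. norm (b n))"
    unfolding l1_rep_def
    by (rule norm_suminf_le[OF monomial_op_aux(2)[OF \<phi> \<rho>] assms(2)]) (use assms in \<open>auto simp: fourier_matrix_def\<close>)
  finally show ?thesis .
qed

lemma semicrossed_product_sequence:
  assumes "A \<in> semicrossed_product \<phi> \<rho>"
  obtains a where "\<And>j. a j \<in> l1C0" "(\<lambda>j. l1_rep \<phi> \<rho> (a j)) \<longlonglongrightarrow> A"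
proof -
  obtain s where s: "\<And>j. s j \<in> l1_rep \<phi> \<rho> ` l1C0" "s \<longlonglongrightarrow> A"
    using assms unfolding semicrossed_product_def closure_sequential by blast
  then obtain a where "\<And>j. a j \<in> l1C0 \<and> s j = l1_rep \<phi> \<rho> (a j)"
    unfolding image_iff by metis
  then show thesis
    using s(2) that[of a] by presburger
qed

text \<open>The matrix identity holds along an approximating sequence from \<open>l1C0\<close>; each
  coordinate involves only finitely many entries, so it survives the limit.\<close>

lemma fourier_matrix_fourier_coeff:
  assumes "A \<in> semicrossed_product \<phi> \<rho>"
  shows "fourier_matrix \<phi> \<rho> A (\<lambda>n. fourier_coeff \<phi> \<rho> n A)"
proof -
  obtain a where a: "\<And>j. a j \<in> l1C0" "(\<lambda>j. l1_rep \<phi> \<rho> (a j)) \<longlonglongrightarrow> A"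
    using semicrossed_product_sequence[OF assms] by blast
  let ?E = "\<lambda>n. fourier_coeff \<phi> \<rho> n A"
  have lim: "(\<lambda>j. a j n) \<longlonglongrightarrow> ?E n" for n
    by (rule fourier_coeff_tendsto[OF \<phi> \<rho> a])
  have aC: "a j n \<in> C0" for j n using a(1)[of j] by (simp add: l1C0_def)
  have EC: "?E n \<in> C0" for n
    by (rule closed_sequentially[OF closed_C0 aC lim])
  \<comment> \<open>\<open>\<rho>\<close> is isometric on \<open>C0\<close> and \<open>alpha\<close>
    is contractive, so convergence of coefficients carries over to matrix entries.\<close>
  have rlim: "(\<lambda>j. \<rho> (alpha \<phi> k (a j n))) \<longlonglongrightarrow> \<rho> (alpha \<phi> k (?E n))" for k n
  proof (rule Lim_transform_bound[OF _ LIM_zero[OF lim], THEN LIM_zero_cancel])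
    have "norm (\<rho> (alpha \<phi> k (a j n)) - \<rho> (alpha \<phi> k (?E n))) = norm (alpha \<phi> k (a j n - ?E n))" for j
      by (simp add: rep_diff[OF \<rho> C0_alpha[OF \<phi> aC] C0_alpha[OF \<phi> EC], symmetric] alpha_diff[OF \<phi>(1)]
          rep_isometric[OF \<rho> C0_diff[OF C0_alpha[OF \<phi> aC] C0_alpha[OF \<phi> EC]]])
    then show "\<forall>\<^sub>F j in sequentially. norm (\<rho> (alpha \<phi> k (a j n)) - \<rho> (alpha \<phi> k (?E n)))
        \<le> norm (a j n - ?E n)"
      by (simp add: norm_alpha_le[OF \<phi>(1)])
  qed
  show ?thesis
    unfolding fourier_matrix_def
  proof (intro conjI allI EC)
    fix x :: "'h ell2" and m
    have "(\<lambda>j. ell2_nth (blinfun_apply (l1_rep \<phi> \<rho> (a j)) x) m)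
        \<longlonglongrightarrow> ell2_nth (blinfun_apply A x) m"
      by (intro bounded_linear.tendsto[OF bounded_linear_ell2_nth] tendsto_intros a(2))
    moreover have "(\<lambda>j. ell2_nth (blinfun_apply (l1_rep \<phi> \<rho> (a j)) x) m)
        \<longlonglongrightarrow> (\<Sum>n\<le>m. blinfun_apply (\<rho> (alpha \<phi> (m - n) (?E n))) (ell2_nth x (m - n)))"
      unfolding fourier_matrix_nth[OF fourier_matrix_l1_rep[OF a(1)]]
      by (intro tendsto_sum tendsto_intros rlim)
    ultimately show "ell2_nth (blinfun_apply A x) m =
        (\<Sum>n\<le>m. blinfun_apply (\<rho> (alpha \<phi> (m - n) (?E n))) (ell2_nth x (m - n)))"
      by (rule LIMSEQ_unique)
  qed
qed

section \<open>Monomials in the associated ideal\<close>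

lemma single_l1C0: "f \<in> C0 \<Longrightarrow> (\<lambda>_. 0)(n := f) \<in> l1C0"
  unfolding l1C0_def by (auto simp: C0_zero intro: summable_finite[of "{n}"] split: if_splits)

lemma l1_rep_single:
  assumes "f \<in> C0"
  shows "l1_rep \<phi> \<rho> ((\<lambda>_. 0)(n := f)) = monomial_op \<phi> \<rho> n f"
proof -
  have "monomial_op \<phi> \<rho> k 0 = 0" for k
    using monomial_op_aux(2)[OF \<phi> \<rho> C0_zero, of k] by simp
  then have "(\<lambda>k. monomial_op \<phi> \<rho> k (((\<lambda>_. 0)(n := f)) k))
      = (\<lambda>k. if k = n then monomial_op \<phi> \<rho> k f else 0)"
    by auto
  then show ?thesis
    unfolding l1_rep_def using sums_single[of n "\<lambda>k. monomial_op \<phi> \<rho> k f"] by (simp add: sums_iff)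
qed

text \<open>Supplies ideal elements for both directions: test monomials of positive degree in one,
  the approximate unit in degree \<open>0\<close> in the other.\<close>

lemma monomial_op_in_assoc_ideal:
  assumes f: "f \<in> C0" and X: "\<And>x. x \<in> X n \<Longrightarrow> apply_bcontfun f x = 0"
  shows "monomial_op \<phi> \<rho> n f \<in> assoc_ideal \<phi> \<rho> X"
proof -
  have "monomial_op \<phi> \<rho> n f \<in> semicrossed_product \<phi> \<rho>"
    unfolding semicrossed_product_def l1_rep_single[OF f, symmetric]
    by (intro subsetD[OF closure_subset] imageI single_l1C0 f)
  moreover have "fourier_coeff \<phi> \<rho> k (monomial_op \<phi> \<rho> n f) = (if k = n then f else 0)" for k
    using fourier_coeff_l1_rep[OF \<phi> \<rho> single_l1C0[OF f], of k n] by (simp add: l1_rep_single[OF f])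
  ultimately show ?thesis
    using X by (auto simp: assoc_ideal_def)
qed

section \<open>Fejer's theorem for Cesaro means\<close>

lemma cesaro_mean_l1C0:
  assumes "\<And>n. a n \<in> C0"
  shows "(\<lambda>n. (real (N - n) / real N) *\<^sub>R a n) \<in> l1C0"
  \<comment> \<open>Truncated subtraction makes the weight \<open>0\<close> for
    \<open>n \<ge> N\<close>, so the support is finite whatever the growth of
    \<open>a\<close>.\<close>
  using assms by (auto simp: l1C0_def C0_scaleR intro!: summable_finite[of "{..<N}"])

text \<open>Dominated convergence for series: each weight tends to \<open>1\<close>, and the error
  in the \<open>n\<close>-th term is at most \<open>norm (a n)\<close> for every
  \<open>N\<close>.\<close>

lemma cesaro_mean_l1_tendsto:
  assumes a: "a \<in> l1C0"
  shows "(\<lambda>N. l1_rep \<phi> \<rho> (\<lambda>n. (real (N - n) / real N) *\<^sub>R a n)) \<longlonglongrightarrow> l1_rep \<phi> \<rho> a"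
proof -
  have aC: "a n \<in> C0" for n using a by (simp add: l1C0_def)
  have sa: "summable (\<lambda>n. norm (a n))" using a by (simp add: l1C0_def)
  let ?w = "\<lambda>n N :: nat. \<bar>real (N - n) / real N - 1\<bar> * norm (a n)"
  have w1: "\<bar>real (N - n) / real N - 1\<bar> \<le> 1" for n N
    by (auto simp: abs_le_iff divide_simps)
  have wle: "norm (?w n N) \<le> norm (a n)" for n N
    using mult_right_mono[OF w1 norm_ge_zero] by (simp add: abs_mult)
  have "((\<lambda>N. ?w n N) \<longlongrightarrow> 0) sequentially" for n
  proof -
    have "(\<lambda>N. real n / real N) \<longlonglongrightarrow> 0" by (rule lim_const_over_n)
    \<comment> \<open>For \<open>N > n\<close> the subtraction is not truncated, and the weight
      falls short of \<open>1\<close> by exactly \<open>n / N\<close>.\<close>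
    moreover have "\<forall>\<^sub>F N in sequentially. real n / real N = \<bar>real (N - n) / real N - 1\<bar>"
      using eventually_gt_at_top[of n] by eventually_elim (simp add: of_nat_diff field_simps)
    ultimately have "(\<lambda>N. \<bar>real (N - n) / real N - 1\<bar>) \<longlonglongrightarrow> 0"
      by (rule Lim_transform_eventually)
    then show ?thesis by (rule tendsto_mult_left_zero)
  qed
  moreover have "\<forall>\<^sub>F (n, N) in sequentially \<times>\<^sub>F sequentially. norm (?w n N) \<le> norm (a n)"
    using wle by (intro always_eventually) auto
  ultimately have "(\<lambda>N. \<Sum>n. ?w n N) \<longlonglongrightarrow> 0"
    using tannerys_theorem[of ?w "\<lambda>_. 0" sequentially "\<lambda>n. norm (a n)"] sa by simp
  moreover
  have "norm (l1_rep \<phi> \<rho> (\<lambda>n. (real (N - n) / real N) *\<^sub>R a n) - l1_rep \<phi> \<rho> a) \<le> (\<Sum>n. ?w n N)" for N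
  proof -
    have eq: "norm ((real (N - n) / real N) *\<^sub>R a n - a n) = ?w n N" for n
      by (metis norm_scaleR scaleR_left_diff_distrib scaleR_one)
    have "summable (\<lambda>n. ?w n N)"
      by (rule summable_comparison_test'[OF sa, where N = 0]) (rule wle)
    then show ?thesis
      using norm_fourier_matrix_le[OF fourier_matrix_diff[OF
            fourier_matrix_l1_rep[OF cesaro_mean_l1C0[of a N, OF aC]] fourier_matrix_l1_rep[OF a]]]
      by (simp add: eq)
  qed
  then have "\<forall>\<^sub>F N in sequentially.
      norm (l1_rep \<phi> \<rho> (\<lambda>n. (real (N - n) / real N) *\<^sub>R a n) - l1_rep \<phi> \<rho> a) \<le> (\<Sum>n. ?w n N)"
    by (intro always_eventually allI)
  ultimately have "(\<lambda>N. l1_rep \<phi> \<rho> (\<lambda>n. (real (N - n) / real N) *\<^sub>R a n) - l1_rep \<phi> \<rho> a) \<longlonglongrightarrow> 0"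
    by (rule Lim_null_comparison[rotated])
  then show ?thesis by (rule LIM_zero_cancel)
qed

text \<open>Choosing a summable \<open>b\<close> with \<open>l1_rep \<phi> \<rho> b\<close> near
  \<open>A\<close> reduces the claim to the summable case: by contractivity, the means of
  \<open>A\<close> and of \<open>b\<close> stay as close as the operators.\<close>

lemma cesaro_mean_approximates:
  assumes A: "A \<in> semicrossed_product \<phi> \<rho>" and e: "e > 0"
  obtains N where
    "norm (l1_rep \<phi> \<rho> (\<lambda>n. (real (N - n) / real N) *\<^sub>R fourier_coeff \<phi> \<rho> n A) - A) < e"
proof -
  let ?E = "\<lambda>n. fourier_coeff \<phi> \<rho> n A"
  let ?m = "\<lambda>N a. l1_rep \<phi> \<rho> (\<lambda>n. (real (N - n) / real N) *\<^sub>R a n)"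
  have E: "fourier_matrix \<phi> \<rho> A ?E" by (rule fourier_matrix_fourier_coeff[OF A])
  obtain b where b: "b \<in> l1C0" "norm (A - l1_rep \<phi> \<rho> b) < e / 3"
    using A e closure_approachable[of A "l1_rep \<phi> \<rho> ` l1C0"]
    by (auto simp: semicrossed_product_def dist_norm norm_minus_commute dest!: spec[of _ "e / 3"])
  have "\<forall>\<^sub>F N in sequentially. dist (?m N b) (l1_rep \<phi> \<rho> b) < e / 3"
    using cesaro_mean_l1_tendsto[OF b(1)] e by (auto dest!: tendstoD[of _ _ _ "e / 3"])
  then have "\<forall>\<^sub>F N in sequentially. N > 0 \<and> dist (?m N b) (l1_rep \<phi> \<rho> b) < e / 3"
    using eventually_gt_at_top[of 0] by eventually_elim simp
  then obtain N where N: "N > 0" "norm (?m N b - l1_rep \<phi> \<rho> b) < e / 3"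
    unfolding dist_norm using eventually_happens trivial_limit_sequentially by blast
  have B: "fourier_matrix \<phi> \<rho> (l1_rep \<phi> \<rho> b) b" by (rule fourier_matrix_l1_rep[OF b(1)])
  \<comment> \<open>Means are linear in the coefficients, so this difference is the Cesaro mean of
    \<open>A - l1_rep \<phi> \<rho> b\<close>.\<close>
  have "fourier_matrix \<phi> \<rho> (?m N ?E - ?m N b) (\<lambda>n. (real (N - n) / real N) *\<^sub>R (?E n - b n))"
    using fourier_matrix_diff[OF fourier_matrix_l1_rep[OF cesaro_mean_l1C0[OF fourier_matrix_C0[OF E], of N]]
        fourier_matrix_l1_rep[OF cesaro_mean_l1C0[OF fourier_matrix_C0[OF B], of N]]]
    by (simp add: scaleR_diff_right)
  then have "norm (?m N ?E - ?m N b) \<le> norm (A - l1_rep \<phi> \<rho> b)"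
    using cesaro_mean_contractive[OF fourier_matrix_diff[OF E B] _ N(1) \<phi> \<rho>] by blast
  then have "norm ((?m N ?E - ?m N b) + (?m N b - l1_rep \<phi> \<rho> b) + (l1_rep \<phi> \<rho> b - A)) < e"
    using b(2) N(2)
      norm_triangle_ineq[of "(?m N ?E - ?m N b) + (?m N b - l1_rep \<phi> \<rho> b)" "l1_rep \<phi> \<rho> b - A"]
      norm_triangle_ineq[of "?m N ?E - ?m N b" "?m N b - l1_rep \<phi> \<rho> b"]
      norm_minus_commute[of A "l1_rep \<phi> \<rho> b"]
    by linarith
  then show thesis by (intro that[of N]) simp
qed

text \<open>A right factor of degree \<open>0\<close> moves no power of \<open>U\<close> across the
  coefficients, so they are simply multiplied by \<open>g\<close>; in matrix terms,
  \<open>alpha\<close> and \<open>\<rho>\<close> are multiplicative.\<close>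

lemma fourier_matrix_times:
  assumes B: "fourier_matrix \<phi> \<rho> B b" and g: "g \<in> C0"
  shows "fourier_matrix \<phi> \<rho> (B o\<^sub>L monomial_op \<phi> \<rho> 0 g) (\<lambda>n. times_fun (b n) g)"
proof -
  have bC: "b n \<in> C0" for n by (rule fourier_matrix_C0[OF B])
  show ?thesis
    unfolding fourier_matrix_def
  proof (intro conjI allI)
    show "times_fun (b n) g \<in> C0" for n by (rule C0_times[OF bC])
    show "ell2_nth (blinfun_apply (B o\<^sub>L monomial_op \<phi> \<rho> 0 g) x) m =
        (\<Sum>n\<le>m. blinfun_apply (\<rho> (alpha \<phi> (m - n) (times_fun (b n) g))) (ell2_nth x (m - n)))" for x m
      by (simp add: fourier_matrix_nth[OF B] monomial_op_aux(1)[OF \<phi> \<rho> g] alpha_times_fun[OF \<phi>(1)]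
          rep_times[OF \<rho> C0_alpha[OF \<phi> bC] C0_alpha[OF \<phi> g]])
  qed
qed

text \<open>Left multiplication by \<open>U\<^sup>n f\<close> raises degrees by \<open>n\<close>, so
  degree \<open>n\<close> of the product sees only degree \<open>0\<close> of \<open>u\<close>.
  Reading off a coefficient is contractive.\<close>

lemma norm_coeff_diff_le:
  assumes f: "f \<in> C0" and u: "u \<in> semicrossed_product \<phi> \<rho>"
  shows "norm (times_fun f (fourier_coeff \<phi> \<rho> 0 u) - f)
    \<le> norm ((monomial_op \<phi> \<rho> n f o\<^sub>L u) - monomial_op \<phi> \<rho> n f)"
proof -
  let ?E = "fourier_coeff \<phi> \<rho> 0 u"
  let ?D = "(monomial_op \<phi> \<rho> n f o\<^sub>L u) - monomial_op \<phi> \<rho> n f"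
  note u_matrix = fourier_matrix_fourier_coeff[OF u]
  have EC: "?E \<in> C0" by (rule fourier_matrix_C0[OF u_matrix])
  have fEC: "times_fun f ?E \<in> C0" by (rule C0_times[OF f])
  have "norm (\<rho> (times_fun f ?E - f)) \<le> norm ?D"
  proof (rule norm_blinfun_bound)
    fix \<xi>
    have "blinfun_apply (\<rho> (times_fun f ?E - f)) \<xi> = ell2_nth (blinfun_apply ?D (\<xi> \<otimes>e 0)) n"
      by (simp add: rep_diff[OF \<rho> fEC f] rep_times[OF \<rho> f EC] blinfun.diff_left
          monomial_op_aux(1)[OF \<phi> \<rho> f] fourier_matrix_single[OF u_matrix] ell2_single.rep_eq)
    also have "norm \<dots> \<le> norm (blinfun_apply ?D (\<xi> \<otimes>e 0))" by (rule norm_ell2_nth_le)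
    also have "\<dots> \<le> norm ?D * norm \<xi>" using norm_blinfun[of ?D "\<xi> \<otimes>e 0"] by simp
    finally show "norm (blinfun_apply (\<rho> (times_fun f ?E - f)) \<xi>) \<le> norm ?D * norm \<xi>" .
  qed simp
  then show ?thesis by (simp add: rep_isometric[OF \<rho> C0_diff[OF fEC f]])
qed

end


section \<open>Approximate units\<close>

text \<open>The net is indexed by a finite set paired with a number \<open>n\<close> that sets the
  tolerance \<open>1 / (n + 1)\<close>, ordered by inclusion and size.\<close>

lemma has_right_approximate_unit_finiteI:
  fixes \<A> :: "('b::real_normed_vector \<Rightarrow>\<^sub>L 'b) set"
  assumes "r > 0"
    and "\<And>F e. finite F \<Longrightarrow> F \<subseteq> \<A> \<Longrightarrow> e > 0 \<Longrightarrow>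
      \<exists>u\<in>\<A>. norm u \<le> r \<and> (\<forall>a\<in>F. dist (a o\<^sub>L u) a < e)"
  shows "has_right_approximate_unit \<A>"
proof -
  define \<Lambda> where "\<Lambda> = {F. finite F \<and> F \<subseteq> \<A>} \<times> (UNIV :: nat set)"
  define le where "le = (\<lambda>p q :: ('b \<Rightarrow>\<^sub>L 'b) set \<times> nat. fst p \<subseteq> fst q \<and> snd p \<le> snd q)"
  have "\<exists>u\<in>\<A>. norm u \<le> r \<and> (\<forall>a\<in>fst p. dist (a o\<^sub>L u) a < inverse (real (Suc (snd p))))"
    if "p \<in> \<Lambda>" for p
    using that by (intro assms(2)) (auto simp: \<Lambda>_def)
  then obtain u where u: "\<And>p. p \<in> \<Lambda> \<Longrightarrow> u p \<in> \<A>" "\<And>p. p \<in> \<Lambda> \<Longrightarrow> norm (u p) \<le> r"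
    "\<And>p a. p \<in> \<Lambda> \<Longrightarrow> a \<in> fst p \<Longrightarrow> dist (a o\<^sub>L u p) a < inverse (real (Suc (snd p)))"
    by metis
  have "right_approximate_unit \<A> \<Lambda> le u"
    unfolding right_approximate_unit_def
  proof (intro conjI ballI exI[of _ r])
    have "\<exists>k\<in>\<Lambda>. le i k \<and> le j k" if "i \<in> \<Lambda>" "j \<in> \<Lambda>" for i j
      using that
      by (intro bexI[of _ "(fst i \<union> fst j, max (snd i) (snd j))"]) (auto simp: \<Lambda>_def le_def)
    moreover have "({}, 0) \<in> \<Lambda>" by (simp add: \<Lambda>_def)
    ultimately show "directed_set \<Lambda> le"
      unfolding directed_set_def by (auto simp: le_def)
    fix a assume a: "a \<in> \<A>"
    show "net_tendsto \<Lambda> le (\<lambda>p. a o\<^sub>L u p) a"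
      unfolding net_tendsto_def
    proof (intro allI impI)
      fix e :: real assume "e > 0"
      then obtain n where n: "inverse (real (Suc n)) < e"
        using reals_Archimedean by blast
      show "\<exists>p\<in>\<Lambda>. \<forall>q\<in>\<Lambda>. le p q \<longrightarrow> dist (a o\<^sub>L u q) a < e"
      proof (intro bexI[of _ "({a}, n)"] ballI impI)
        show "({a}, n) \<in> \<Lambda>" using a by (simp add: \<Lambda>_def)
        fix q assume q: "q \<in> \<Lambda>" "le ({a}, n) q"
        then have "dist (a o\<^sub>L u q) a < inverse (real (Suc (snd q)))"
          by (intro u(3)) (auto simp: le_def)
        also have "\<dots> \<le> inverse (real (Suc n))"
          using q(2) by (simp add: le_def)
        finally show "dist (a o\<^sub>L u q) a < e" using n by simp
      qed
    qed
  qed (use u assms(1) in auto)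
  then show ?thesis by (rule has_right_approximate_unitI)
qed

text \<open>Cesaro means of ideal elements have finitely many nonzero coefficients, all vanishing on
  \<open>S\<close>. One function \<open>g\<close> therefore serves the chosen means of all members
  of \<open>F\<close> at once.\<close>

lemma assoc_ideal_constant_has_right_approximate_unit:
  fixes \<phi> :: "'a::topological_space \<Rightarrow> 'a"
    and \<rho> :: "('a \<Rightarrow>\<^sub>C complex) \<Rightarrow> ('h::complex_hilbert \<Rightarrow>\<^sub>L 'h)"
  assumes \<phi>: "continuous_on UNIV \<phi>" "proper \<phi>" and \<rho>: "faithful_representation \<rho>"
    and X: "\<And>n. X n = S"
  shows "has_right_approximate_unit (assoc_ideal \<phi> \<rho> X)"
proof (rule has_right_approximate_unit_finiteI[of 1])
  fix F :: "('h ell2 \<Rightarrow>\<^sub>L 'h ell2) set" and e :: real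
  assume F: "finite F" "F \<subseteq> assoc_ideal \<phi> \<rho> X" and e: "e > 0"
  let ?E = "\<lambda>A n. fourier_coeff \<phi> \<rho> n A"
  let ?c = "\<lambda>N A n. (real (N - n) / real N) *\<^sub>R ?E A n"
  let ?m = "\<lambda>N A. l1_rep \<phi> \<rho> (?c N A)"
  have scp: "A \<in> semicrossed_product \<phi> \<rho>" if "A \<in> F" for A
    using F(2) that by (auto simp: assoc_ideal_def)
  have EC: "?E A n \<in> C0" if "A \<in> F" for A n
    by (rule fourier_matrix_C0[OF fourier_matrix_fourier_coeff[OF \<phi> \<rho> scp[OF that]]])
  have ES: "apply_bcontfun (?E A n) x = 0" if "A \<in> F" "x \<in> S" for A n x
    using F(2) that X by (auto simp: assoc_ideal_def)
  have "\<forall>A\<in>F. \<exists>N. norm (?m N A - A) < e / 3"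
  proof
    fix A assume "A \<in> F"
    from cesaro_mean_approximates[OF \<phi> \<rho> scp[OF this], of "e / 3"] e
    show "\<exists>N. norm (?m N A - A) < e / 3" by auto
  qed
  from bchoice[OF this] obtain N where N: "\<And>A. A \<in> F \<Longrightarrow> norm (?m (N A) A - A) < e / 3"
    by blast
  \<comment> \<open>\<open>M\<close> exceeds every order \<open>N A\<close>, so all chosen means
    have their coefficients below degree \<open>M\<close>.\<close>
  define M where "M = Suc (\<Sum>A\<in>F. N A)"
  have NM: "N A < M" if "A \<in> F" for A
    using member_le_sum[OF that, of N] F(1) by (simp add: M_def)
  have M: "M > 0" by (simp add: M_def)
  define G where "G = (\<Union>A\<in>F. ?c (N A) A ` {..<M})"
  \<comment> \<open>Each mean has at most \<open>M\<close> nonzero coefficients, so errors of this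
    size add up to at most \<open>e / 3\<close>.\<close>
  have d: "e / (3 * real M) > 0" using e M by simp
  obtain g where g: "g \<in> C0" "norm g \<le> 1" "\<And>x. x \<in> S \<Longrightarrow> apply_bcontfun g x = 0"
    "\<And>f. f \<in> G \<Longrightarrow> norm (times_fun f g - f) \<le> e / (3 * real M)"
    by (rule C0_approximate_unit[OF _ _ _ d, of G S])
      (use F(1) C0_scaleR[OF EC] ES in \<open>auto simp: G_def\<close>)
  define u where "u = monomial_op \<phi> \<rho> 0 g"
  have nu: "norm u \<le> 1"
    unfolding u_def using monomial_op_aux(2)[OF \<phi> \<rho> g(1)] g(2) by (rule order_trans)
  have "dist (A o\<^sub>L u) A < e" if A: "A \<in> F" for A
  proof -
    let ?B = "?m (N A) A" and ?b = "?c (N A) A"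
    have b: "?b \<in> l1C0" by (rule cesaro_mean_l1C0[OF \<phi> \<rho> EC[OF A]])
    note B = fourier_matrix_l1_rep[OF \<phi> \<rho> b]
    note D = fourier_matrix_diff[OF \<phi> \<rho> fourier_matrix_times[OF \<phi> \<rho> B g(1)] B]
    have zero: "norm (times_fun (?b n) g - ?b n) = 0" if "n \<notin> {..<M}" for n
    proof -
      have "times_fun (?b n) g - ?b n = 0"
        using NM[OF A] that by (intro bcontfun_eqI) simp
      then show ?thesis by (simp only: norm_zero)
    qed
    have "norm ((?B o\<^sub>L u) - ?B) \<le> (\<Sum>n. norm (times_fun (?b n) g - ?b n))"
      unfolding u_def
      by (intro norm_fourier_matrix_le[OF \<phi> \<rho> D] summable_finite[of "{..<M}"] zero) simp
    also have "\<dots> = (\<Sum>n<M. norm (times_fun (?b n) g - ?b n))"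
      by (intro suminf_finite zero) simp
    also have "\<dots> \<le> (\<Sum>n<M. e / (3 * real M))"
      unfolding G_def by (intro sum_mono g(4)[unfolded G_def] UN_I[OF A] imageI)
    finally have mid: "norm ((?B o\<^sub>L u) - ?B) \<le> e / 3" using M by simp
    have "norm ((A - ?B) o\<^sub>L u) \<le> norm (A - ?B) * norm u"
      by (rule norm_blinfun_compose)
    also have "\<dots> \<le> norm (A - ?B)" using nu by (simp add: mult_left_le)
    finally have left: "norm ((A - ?B) o\<^sub>L u) < e / 3"
      using N[OF A] by (simp add: norm_minus_commute)
    \<comment> \<open>The outer terms are small by the approximation of \<open>A\<close> and
      \<open>norm u \<le> 1\<close>, the middle one by the choice of \<open>g\<close>.\<close>
    have eq: "(A o\<^sub>L u) - A = ((A - ?B) o\<^sub>L u) + ((?B o\<^sub>L u) - ?B) + (?B - A)"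
      by (rule blinfun_eqI) (simp add: blinfun.diff_left blinfun.add_left)
    show ?thesis
      using norm_triangle_ineq[of "((A - ?B) o\<^sub>L u) + ((?B o\<^sub>L u) - ?B)" "?B - A"]
        norm_triangle_ineq[of "(A - ?B) o\<^sub>L u" "(?B o\<^sub>L u) - ?B"] left mid N[OF A]
      unfolding dist_norm eq by linarith
  qed
  moreover have "u \<in> assoc_ideal \<phi> \<rho> X"
    unfolding u_def using X g by (intro monomial_op_in_assoc_ideal[OF \<phi> \<rho>]) auto
  ultimately show "\<exists>u\<in>assoc_ideal \<phi> \<rho> X. norm u \<le> 1 \<and> (\<forall>A\<in>F. dist (A o\<^sub>L u) A < e)"
    using nu by blast
qed simp

theorem theorem2p1:
  fixes \<phi> :: "'a::t2_space \<Rightarrow> 'a"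
    and \<rho> :: "('a \<Rightarrow>\<^sub>C complex) \<Rightarrow> ('h::complex_hilbert \<Rightarrow>\<^sub>L 'h)"
    and X :: "nat \<Rightarrow> 'a set"
  assumes "locally_compact_space (euclidean :: 'a topology)"
    and "continuous_on UNIV \<phi>" and "proper \<phi>" and "surj \<phi>"
    and "faithful_representation \<rho>"
    and "\<And>n. closed (X n)"
    and "\<And>n. X (Suc n) \<union> \<phi> ` X (Suc n) \<subseteq> X n"
    and "assoc_ideal \<phi> \<rho> X \<noteq> {0}"
  shows "has_right_approximate_unit (assoc_ideal \<phi> \<rho> X) \<longleftrightarrow> (\<forall>n. X n = X (Suc n))"
proof
  note \<phi> = assms(2,3) and \<rho> = assms(5)
  have dec: "X (Suc n) \<subseteq> X n" for n using assms(7)[of n] by blast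
  assume "has_right_approximate_unit (assoc_ideal \<phi> \<rho> X)"
  then obtain \<Lambda> :: "(('h ell2 \<Rightarrow>\<^sub>L 'h ell2) set \<times> nat) set" and le u
    where u: "right_approximate_unit (assoc_ideal \<phi> \<rho> X) \<Lambda> le u"
    unfolding has_right_approximate_unit_def by blast
  have "X n \<subseteq> X (Suc n)" for n
  proof (rule subsetI, rule ccontr)
    fix x assume x: "x \<in> X n" "x \<notin> X (Suc n)"
    obtain f where f: "f \<in> C0" "apply_bcontfun f x = 1"
      "\<And>y. y \<in> X (Suc n) \<Longrightarrow> apply_bcontfun f y = 0"
      using C0_Urysohn[OF assms(1,6) x(2)] by blast
    let ?M = "monomial_op \<phi> \<rho> (Suc n) f"
    have "?M \<in> assoc_ideal \<phi> \<rho> X"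
      by (rule monomial_op_in_assoc_ideal[OF \<phi> \<rho> f(1,3)])
    then have "net_tendsto \<Lambda> le (\<lambda>i. ?M o\<^sub>L u i) ?M"
      using u unfolding right_approximate_unit_def by blast
    then obtain i where i: "i \<in> \<Lambda>" "\<And>j. j \<in> \<Lambda> \<Longrightarrow> le i j \<Longrightarrow> dist (?M o\<^sub>L u j) ?M < 1"
      unfolding net_tendsto_def by (metis zero_less_one)
    \<comment> \<open>By reflexivity the index \<open>i\<close> itself may be used; a single member
      of the net gives the contradiction.\<close>
    have "le i i" and uI: "u i \<in> assoc_ideal \<phi> \<rho> X"
      using u i(1) unfolding right_approximate_unit_def directed_set_def by simp_all
    then have lt: "norm ((?M o\<^sub>L u i) - ?M) < 1"
      using i(2)[OF i(1)] by (simp add: dist_norm)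
    have scp: "u i \<in> semicrossed_product \<phi> \<rho>" using uI by (simp add: assoc_ideal_def)
    have "X n \<subseteq> X 0" by (rule lift_Suc_antimono_le[of X, OF dec]) simp
    then have "apply_bcontfun (fourier_coeff \<phi> \<rho> 0 (u i)) x = 0"
      using uI x(1) by (auto simp: assoc_ideal_def)
    \<comment> \<open>At \<open>x\<close> the product vanishes while \<open>f\<close> is
      \<open>1\<close>, so the distance is at least \<open>1\<close>, against the tolerance chosen
      above.\<close>
    then have "1 = cmod (apply_bcontfun (times_fun f (fourier_coeff \<phi> \<rho> 0 (u i)) - f) x)"
      by (simp add: f(2))
    also have "\<dots> \<le> norm (times_fun f (fourier_coeff \<phi> \<rho> 0 (u i)) - f)"
      by (rule norm_bounded)
    also have "\<dots> < 1"
      using norm_coeff_diff_le[OF \<phi> \<rho> f(1) scp] lt by (rule le_less_trans)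
    finally show False by simp
  qed
  then show "\<forall>n. X n = X (Suc n)" using dec by blast
next
  assume "\<forall>n. X n = X (Suc n)"
  then have "X n = X 0" for n by (induction n) auto
  then show "has_right_approximate_unit (assoc_ideal \<phi> \<rho> X)"
    by (rule assoc_ideal_constant_has_right_approximate_unit[OF assms(2,3,5)])
qed

end
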